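(* Let $K$ be a field and $n\ge1$, and let $1$ be the identity element of $K[x_1,\dots,x_n]$. For each $\lambda=(\lambda_1,\dots,\lambda_n)\in\mathscr{P}_n$, $$S_\lambda\cdot1=s_\lambda(x_1,\dots,x_n).$$ Hence $z_\lambda$ is the evaluation of $s_\lambda(x_1,\dots,x_n)$ at $x_1:=y_1,\dots,x_n:=y_n$; that is, $$(-1)^{\frac{n(n-1)}2}\psi_{w_0}y_1^{\lambda_1+n-1}y_2^{\lambda_2+n-2}\cdots y_n^{\lambda_n}\equiv s_\lambda(y_1,\dots,y_n)\mod J_n$$ and $$(-1)^{\frac{n(n-1)}2}y_1^{\lambda_1+n-1}y_2^{\lambda_2+n-2}\cdots y_n^{\lambda_n}\psi_{w_0}\equiv s_\lambda(y_1,\dots,y_n)\mod J_n^*.$$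
   Context: $\mathscr{H}_n^{(0)}$ is the unital associative $K$-algebra generated by $\psi_1,\dots,\psi_{n-1},y_1,\dots,y_n$ with relations: $\psi_r^2=0$; $\psi_r\psi_k=\psi_k\psi_r$ if $|r-k|>1$; $\psi_r\psi_{r+1}\psi_r=\psi_{r+1}\psi_r\psi_{r+1}$; $y_ry_k=y_ky_r$; $\psi_ry_{r+1}=y_r\psi_r+1$, $y_{r+1}\psi_r=\psi_ry_r+1$; $\psi_ry_k=y_k\psi_r$ if $k\ne r,r+1$. For $w\in\mathfrak{S}_n$ with reduced expression $w=s_{i_1}\cdots s_{i_k}$ ($s_i=(i,i+1)$), $\psi_w:=\psi_{i_1}\cdots\psi_{i_k}$ (independent of the reduced expression); $w_0$ is the longest element of $\mathfrak{S}_n$. The elements $y_1,\dots,y_n$ are algebraically independent in $\mathscr{H}_n^{(0)}$ and $K[y_1,\dots,y_n]$ is the subalgebra they generate. $\mathscr{H}_n^{(0)}$ acts on $K[x_1,\dots,x_n]$ by $y_k\cdot f=x_kf$ and $\psi_i\cdot f=\partial_i(f):=\dfrac{f-s_i\cdot f}{x_{i+1}-x_i}$, where $s_i$ swaps $x_i$ and $x_{i+1}$. $J_n:=\sum_{s=1}^{n-1}\mathscr{H}_n^{(0)}\psi_s$ and $J_n^*:=\sum_{s=1}^{n-1}\psi_s\mathscr{H}_n^{(0)}$; one has $\mathscr{H}_n^{(0)}=K[y_1,\dots,y_n]\oplus J_n=K[y_1,\dots,y_n]\oplus J_n^*$ as $K$-spaces. $\mathscr{P}_n$ is the set of partitions $\lambda=(\lambda_1\ge\dots\ge\lambda_n\ge0)$.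 For $\lambda\in\mathscr{P}_n$, $S_\lambda:=(-1)^{n(n-1)/2}\psi_{w_0}y_1^{\lambda_1+n-1}y_2^{\lambda_2+n-2}\cdots y_n^{\lambda_n}\in\mathscr{H}_n^{(0)}$, and $z_\lambda$ is the unique element of $K[y_1,\dots,y_n]$ with $S_\lambda\equiv z_\lambda\mod J_n$. The Schur polynomial is $s_\lambda=a_{\lambda+\delta}/a_\delta$, where $\delta=(n-1,n-2,\dots,1,0)$ and $a_\mu(x_1,\dots,x_n)=\sum_{w\in\mathfrak{S}_n}(-1)^{\ell(w)}x_{w(1)}^{\mu_1}\cdots x_{w(n)}^{\mu_n}$, $\ell(w)$ being the Coxeter length. *)

theory Defs
  imports
    "HOL-Library.Poly_Mapping"
    "HOL-Combinatorics.Permutations"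
    "HOL-Algebra.QuotRing"
    "HOL-Algebra.Generated_Rings"
begin

section \<open>Polynomials in $x_1, x_2, \dots$\<close>

text \<open>Polynomials in countably many variables. The ring $K[x_1,\dots,x_n]$ consists of those in
  which only the variables with index in \<open>{1..n}\<close> occur; it is stable under the operators
  \<open>divided_diff i\<close> below for \<open>1 \<le> i < n\<close>, and it contains the quotient \<open>schur n l\<close>.\<close>

type_synonym 'a mpoly = "(nat \<Rightarrow>\<^sub>0 nat) \<Rightarrow>\<^sub>0 'a"

definition PConst :: "'a::field \<Rightarrow> 'a mpoly"
  where "PConst c = Poly_Mapping.single 0 c"

definition PVar :: "nat \<Rightarrow> 'a::field mpoly"
  where "PVar k = Poly_Mapping.single (Poly_Mapping.single k 1) 1"

text \<open>The exact quotient \<open>p / q\<close>. It is unique whenever it exists and \<open>q \<noteq> 0\<close>, polynomials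
  forming an integral domain.\<close>

definition exact_quot :: "'a::field mpoly \<Rightarrow> 'a mpoly \<Rightarrow> 'a mpoly"
  where "exact_quot p q = (THE r. r * q = p)"

text \<open>\<open>swap_vars i\<close> is $f \mapsto s_i \cdot f$. Since $s_i$ is an involution, the coefficient of
  $s_i \cdot f$ at an exponent vector $m$ is that of $f$ at $m \circ s_i$.\<close>

definition swap_vars :: "nat \<Rightarrow> 'a::field mpoly \<Rightarrow> 'a mpoly"
  where "swap_vars i = Poly_Mapping.map_key (Poly_Mapping.map_key (transpose i (Suc i)))"

definition divided_diff :: "nat \<Rightarrow> 'a::field mpoly \<Rightarrow> 'a mpoly"
  where "divided_diff i f = exact_quot (f - swap_vars i f) (PVar (Suc i) - PVar i)"

section \<open>The symmetric group $S_n$ as a Coxeter group\<close>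

definition word_perm :: "nat list \<Rightarrow> nat \<Rightarrow> nat"
  where "word_perm is = foldr (\<lambda>i w. transpose i (Suc i) \<circ> w) is id"

definition cox_length :: "nat \<Rightarrow> (nat \<Rightarrow> nat) \<Rightarrow> nat"
  where "cox_length n w =
    (LEAST k. \<exists>is. set is \<subseteq> {1..<n} \<and> word_perm is = w \<and> length is = k)"

definition reduced_expr :: "nat \<Rightarrow> (nat \<Rightarrow> nat) \<Rightarrow> nat list \<Rightarrow> bool"
  where "reduced_expr n w is \<longleftrightarrow>
    set is \<subseteq> {1..<n} \<and> word_perm is = w \<and> length is = cox_length n w"

definition longest_perm :: "nat \<Rightarrow> nat \<Rightarrow> nat"
  where "longest_perm n =
    (THE w. w permutes {1..n} \<and> (\<forall>v. v permutes {1..n} \<longrightarrow> cox_length n v \<le> cox_length n w))"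

section \<open>Schur polynomials\<close>

text \<open>Partitions $(\lambda_1 \ge \dots \ge \lambda_n \ge 0)$ are functions on the indices
  \<open>{1..n}\<close>, extended by \<open>0\<close>.\<close>

definition partitions_le :: "nat \<Rightarrow> (nat \<Rightarrow> nat) set"
  where "partitions_le n = {l. antimono_on {1..n} l \<and> (\<forall>i. i \<notin> {1..n} \<longrightarrow> l i = 0)}"

definition alternant :: "nat \<Rightarrow> (nat \<Rightarrow> nat) \<Rightarrow> 'a::field mpoly"
  where "alternant n \<mu> =
    (\<Sum>w | w permutes {1..n}. (- 1) ^ cox_length n w * (\<Prod>k = 1..n. PVar (w k) ^ \<mu> k))"

definition schur :: "nat \<Rightarrow> (nat \<Rightarrow> nat) \<Rightarrow> 'a::field mpoly"
  where "schur n l = exact_quot (alternant n (\<lambda>k. l k + (n - k))) (alternant n (\<lambda>k. n - k))"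

section \<open>The nilHecke algebra $\mathscr{H}_n^{(0)}$\<close>

subsection \<open>Free associative algebra\<close>

datatype nh_gen = GPsi nat | GY nat

text \<open>Words in the generators under concatenation. The wrapper is needed because type
  \<open>list\<close> is not an instance of \<open>monoid_add\<close>; the free associative algebra is then the monoid
  algebra \<open>nh_word \<Rightarrow>\<^sub>0 'a\<close> with its convolution product.\<close>

datatype nh_word = Word (letters: "nh_gen list")

instantiation nh_word :: monoid_add
begin

definition zero_nh_word :: nh_word
  where "zero_nh_word = Word []"

definition plus_nh_word :: "nh_word \<Rightarrow> nh_word \<Rightarrow> nh_word"
  where "plus_nh_word u v = Word (letters u @ letters v)"

instance
  by standard (simp_all add: zero_nh_word_def plus_nh_word_def)

end

type_synonym 'a nh_free = "nh_word \<Rightarrow>\<^sub>0 'a"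

definition fconst :: "'a::field \<Rightarrow> 'a nh_free"
  where "fconst c = Poly_Mapping.single 0 c"

definition fpsi :: "nat \<Rightarrow> 'a::field nh_free"
  where "fpsi r = Poly_Mapping.single (Word [GPsi r]) 1"

definition fy :: "nat \<Rightarrow> 'a::field nh_free"
  where "fy k = Poly_Mapping.single (Word [GY k]) 1"

definition nh_gens :: "nat \<Rightarrow> nh_gen set"
  where "nh_gens n = GPsi ` {1..<n} \<union> GY ` {1..n}"

definition free_alg :: "nat \<Rightarrow> 'a::field nh_free ring"
  where "free_alg n =
    \<lparr>carrier = {a. \<forall>w \<in> Poly_Mapping.keys a. set (letters w) \<subseteq> nh_gens n},
     mult = (*), one = 1, zero = 0, add = (+)\<rparr>"

subsection \<open>Relations and quotient\<close>

text \<open>Each defining relation $a = b$ is given by the element $a - b$.\<close>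

definition nh_rels :: "nat \<Rightarrow> 'a::field nh_free set"
  where "nh_rels n =
      {fpsi r * fpsi r | r. r \<in> {1..<n}}
    \<union> {fpsi r * fpsi k - fpsi k * fpsi r | r k.
         r \<in> {1..<n} \<and> k \<in> {1..<n} \<and> \<bar>int r - int k\<bar> > 1}
    \<union> {fpsi r * fpsi (r + 1) * fpsi r - fpsi (r + 1) * fpsi r * fpsi (r + 1) | r.
         r \<in> {1..<n} \<and> r + 1 \<in> {1..<n}}
    \<union> {fy r * fy k - fy k * fy r | r k. r \<in> {1..n} \<and> k \<in> {1..n}}
    \<union> {fpsi r * fy (r + 1) - (fy r * fpsi r + 1) | r. r \<in> {1..<n}}
    \<union> {fy (r + 1) * fpsi r - (fpsi r * fy r + 1) | r. r \<in> {1..<n}}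
    \<union> {fpsi r * fy k - fy k * fpsi r | r k.
         r \<in> {1..<n} \<and> k \<in> {1..n} \<and> k \<noteq> r \<and> k \<noteq> r + 1}"

definition nh_ideal :: "nat \<Rightarrow> 'a::field nh_free set"
  where "nh_ideal n = Idl\<^bsub>free_alg n\<^esub> (nh_rels n)"

text \<open>Elements of the nilHecke algebra are cosets of the free algebra.\<close>

definition nilHecke :: "nat \<Rightarrow> 'a::field nh_free set ring"
  where "nilHecke n = free_alg n Quot nh_ideal n"

definition nh_class :: "nat \<Rightarrow> 'a::field nh_free \<Rightarrow> 'a nh_free set"
  where "nh_class n a = nh_ideal n +>\<^bsub>free_alg n\<^esub> a"

definition nh_const :: "nat \<Rightarrow> 'a::field \<Rightarrow> 'a nh_free set"
  where "nh_const n c = nh_class n (fconst c)"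

definition nh_psi :: "nat \<Rightarrow> nat \<Rightarrow> 'a::field nh_free set"
  where "nh_psi n r = nh_class n (fpsi r)"

definition nh_y :: "nat \<Rightarrow> nat \<Rightarrow> 'a::field nh_free set"
  where "nh_y n k = nh_class n (fy k)"

text \<open>The ordered product of a list; \<open>finprod\<close> is not available, as the algebra is not
  commutative.\<close>

definition nh_prod_list :: "nat \<Rightarrow> 'a::field nh_free set list \<Rightarrow> 'a nh_free set"
  where "nh_prod_list n as = foldr (mult (nilHecke n)) as \<one>\<^bsub>nilHecke n\<^esub>"

text \<open>The product of the generators along a reduced expression does not depend on the choice of
  the latter, by the nil Coxeter relations.\<close>

definition nh_psi_perm :: "nat \<Rightarrow> (nat \<Rightarrow> nat) \<Rightarrow> 'a::field nh_free set"
  where "nh_psi_perm n w = nh_prod_list n (map (nh_psi n) (SOME is. reduced_expr n w is))"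

text \<open>$y_1^{e_1} y_2^{e_2} \cdots y_n^{e_n}$\<close>

definition nh_ymonom :: "nat \<Rightarrow> (nat \<Rightarrow> nat) \<Rightarrow> 'a::field nh_free set"
  where "nh_ymonom n e = nh_prod_list n (map (\<lambda>k. nh_y n k [^]\<^bsub>nilHecke n\<^esub> e k) [1..<n + 1])"

text \<open>Evaluation at $x_k := y_k$, meant for \<open>p\<close> in $K[x_1,\dots,x_n]$ only: variables with index
  outside \<open>{1..n}\<close> would be ignored.\<close>

definition nh_eval :: "nat \<Rightarrow> 'a::field mpoly \<Rightarrow> 'a nh_free set"
  where "nh_eval n p =
    (\<Oplus>\<^bsub>nilHecke n\<^esub>m \<in> Poly_Mapping.keys p.
       nh_const n (Poly_Mapping.lookup p m) \<otimes>\<^bsub>nilHecke n\<^esub> nh_ymonom n (Poly_Mapping.lookup m))"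

text \<open>The subalgebra $K[y_1,\dots,y_n]$; adjoining the scalars makes the generated subring a
  $K$-subalgebra.\<close>

definition nh_ysubalg :: "nat \<Rightarrow> 'a::field nh_free set set"
  where "nh_ysubalg n = generate_ring (nilHecke n) (range (nh_const n) \<union> nh_y n ` {1..n})"

subsection \<open>The polynomial representation\<close>

fun gen_act :: "nh_gen \<Rightarrow> 'a::field mpoly \<Rightarrow> 'a mpoly"
  where
    "gen_act (GPsi i) f = divided_diff i f"
  | "gen_act (GY k) f = PVar k * f"

definition free_act :: "'a::field nh_free \<Rightarrow> 'a mpoly \<Rightarrow> 'a mpoly"
  where "free_act a f =
    (\<Sum>w \<in> Poly_Mapping.keys a. PConst (Poly_Mapping.lookup a w) * foldr gen_act (letters w) f)"

text \<open>A coset acts as any of its representatives; \<open>THE\<close> picks the common value, so that it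
  encodes that the action of the free algebra factors through the quotient.\<close>

definition nh_act :: "'a::field nh_free set \<Rightarrow> 'a mpoly \<Rightarrow> 'a mpoly"
  where "nh_act h f = (THE g. \<forall>a \<in> h. free_act a f = g)"

subsection \<open>The one-sided ideals $J_n$ and $J_n^*$, and the elements $S_\lambda$ and $z_\lambda$\<close>

definition J_left :: "nat \<Rightarrow> 'a::field nh_free set set"
  where "J_left n =
    {(\<Oplus>\<^bsub>nilHecke n\<^esub>s \<in> {1..<n}. h s \<otimes>\<^bsub>nilHecke n\<^esub> nh_psi n s) | h.
       h \<in> {1..<n} \<rightarrow> carrier (nilHecke n)}"

definition J_right :: "nat \<Rightarrow> 'a::field nh_free set set"
  where "J_right n =
    {(\<Oplus>\<^bsub>nilHecke n\<^esub>s \<in> {1..<n}. nh_psi n s \<otimes>\<^bsub>nilHecke n\<^esub> h s) | h.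
       h \<in> {1..<n} \<rightarrow> carrier (nilHecke n)}"

definition nh_cong :: "nat \<Rightarrow> 'a::field nh_free set \<Rightarrow> 'a nh_free set \<Rightarrow> 'a nh_free set set \<Rightarrow> bool"
  where "nh_cong n a b J \<longleftrightarrow> a \<ominus>\<^bsub>nilHecke n\<^esub> b \<in> J"

definition nh_sign :: "nat \<Rightarrow> 'a::field nh_free set"
  where "nh_sign n = (\<ominus>\<^bsub>nilHecke n\<^esub> \<one>\<^bsub>nilHecke n\<^esub>) [^]\<^bsub>nilHecke n\<^esub> (n * (n - 1) div 2)"

definition S_elt :: "nat \<Rightarrow> (nat \<Rightarrow> nat) \<Rightarrow> 'a::field nh_free set"
  where "S_elt n l =
    nh_sign n \<otimes>\<^bsub>nilHecke n\<^esub> nh_psi_perm n (longest_perm n)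
      \<otimes>\<^bsub>nilHecke n\<^esub> nh_ymonom n (\<lambda>k. l k + (n - k))"

definition z_elt :: "nat \<Rightarrow> (nat \<Rightarrow> nat) \<Rightarrow> 'a::field nh_free set"
  where "z_elt n l = (THE z. z \<in> nh_ysubalg n \<and> nh_cong n (S_elt n l) z (J_left n))"

end

theory Submission
  imports Defs
begin

text \<open>The proof reduces both congruences and the description of \<open>z_elt\<close> to one identity in the
  polynomial ring: for every reduced expression \<open>i\<^sub>1, \<dots>, i\<^sub>N\<close> of the longest permutation, the
  iterated divided difference \<open>\<partial>\<^bsub>i\<^sub>1\<^esub> \<dots> \<partial>\<^bsub>i\<^sub>N\<^esub>\<close> sends $x^{\lambda+\delta}$ to
  $(-1)^{n(n-1)/2} s_\lambda$.

  \<^bold>\<open>The polynomial identity.\<close> The divided differences satisfy the braid relations, so by Matsumoto's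
  theorem (\<open>matsumoto\<close>) the operator \<open>T\<close> of a reduced expression of the longest permutation does not
  depend on that expression. As every \<open>i\<close> is the first letter of some reduced expression, every
  \<open>T p\<close> is a symmetric polynomial. Let \<open>A\<close> be the signed sum over all permutations of the variables.
  It vanishes on polynomials fixed by an adjacent transposition (in every characteristic, because the
  terms cancel in pairs), and the twisted Leibniz rule then gives
  $A(q\,x_{i+1}\,\partial_i p) = A(q\,p)$ for every \<open>q\<close> fixed by $s_i$. Starting from
  $x_2 x_3^2 \cdots x_n^{n-1}$, this rule peels off one divided difference and one factor at a
  time along a suitable reduced expression, so that $A(x_2 x_3^2 \cdots x_n^{n-1}\, T p) = A(p)$
  (\<open>antisymmetrize_staircase_word\<close>). By symmetry of \<open>T p\<close> the left-hand side is
  $(-1)^{n(n-1)/2} a_\delta \cdot T p$, and for $p = x^{\lambda+\delta}$ the right-hand side is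
  $a_{\lambda+\delta}$. Dividing by $a_\delta \ne 0$ gives \<open>schur_eq_dd_word\<close>.

  \<^bold>\<open>From polynomials to the algebra.\<close> Elements of the nilHecke algebra are handled through
  representatives in the free algebra. The relations let every $\psi_r$ move to the right past a
  polynomial in the $y_k$: $\psi_r f(y) = (s_r f)(y)\,\psi_r + (\partial_r f)(y)$. Hence each element
  $a$ is congruent modulo $J_n$ to the polynomial $a \cdot 1$ evaluated at the $y_k$
  (\<open>feval_free_act_1_cong\<close>); this is the first congruence. A polynomial is recovered from its value
  at the $y_k$ by acting on \<open>1\<close>, and $J_n$ kills \<open>1\<close>, whence the uniqueness of $z_\lambda$.

  \<^bold>\<open>The right ideal.\<close> Reversing words fixes the generators and permutes the relations up to sign, so it
  induces an anti-automorphism. It exchanges $J_n$ and $J_n^*$, fixes polynomials in the $y_k$, and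
  reverses reduced expressions; since the longest permutation is an involution, the reverse of one of
  its reduced expressions is another one, and the second congruence is the mirror image of the first.\<close>

section \<open>The inversion number and the length\<close>

text \<open>Pairs of positions, not of values: composing with \<open>adj i\<close> on the left, which is what prefixing a
letter to a word does, then changes the set by a single pair.\<close>

definition inversions :: "nat \<Rightarrow> (nat \<Rightarrow> nat) \<Rightarrow> (nat \<times> nat) set"
  where "inversions n w = {(a, b). a \<in> {1..n} \<and> b \<in> {1..n} \<and> a < b \<and> w b < w a}"

abbreviation adj :: "nat \<Rightarrow> nat \<Rightarrow> nat"
  where "adj i \<equiv> transpose i (Suc i)"

abbreviation pinv :: "(nat \<Rightarrow> nat) \<Rightarrow> nat \<Rightarrow> nat"
  where "pinv w \<equiv> inv_into UNIV w"

lemma word_perm_simps [simp]: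
  "word_perm [] = id" "word_perm (i # is) = adj i \<circ> word_perm is"
  by (simp_all add: word_perm_def)

lemma word_perm_append: "word_perm (is @ js) = word_perm is \<circ> word_perm js"
  by (induction "is") (simp_all add: o_assoc)

lemma adj_permutes: "i \<in> {1..<n} \<Longrightarrow> adj i permutes {1..n}"
  by (rule permutes_swap_id) auto

lemma word_perm_permutes: "set is \<subseteq> {1..<n} \<Longrightarrow> word_perm is permutes {1..n}"
proof (induction "is")
  case Nil
  then show ?case by (simp add: permutes_id del: id_apply)
next
  case (Cons i "is")
  then show ?case
    unfolding word_perm_simps by (intro permutes_compose Cons.IH adj_permutes) auto
qed

lemma finite_inversions [simp]: "finite (inversions n w)"
  by (rule finite_subset[of _ "{1..n} \<times> {1..n}"]) (auto simp: inversions_def)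

lemma inversions_id [simp]: "inversions n id = {}"
  by (auto simp: inversions_def)

lemma inversions_adj_ascent:
  assumes w: "w permutes {1..n}" and i: "i \<in> {1..<n}" and asc: "pinv w i < pinv w (Suc i)"
  shows "inversions n (adj i \<circ> w) = insert (pinv w i, pinv w (Suc i)) (inversions n w)"
    and "(pinv w i, pinv w (Suc i)) \<notin> inversions n w"
proof -
  define a b where "a = pinv w i" and "b = pinv w (Suc i)"
  have wa: "w a = i" and wb: "w b = Suc i"
    using permutes_inverses(1)[OF w] by (auto simp: a_def b_def)
  have inj: "w x = w y \<longleftrightarrow> x = y" for x y
    using permutes_inj[OF w] by (auto dest: injD)
  have ab: "a \<in> {1..n}" "b \<in> {1..n}"
    using i wa wb permutes_in_image[OF w] by (metis atLeastAtMost_iff atLeastLessThan_iff less_imp_le_nat, metis atLeastAtMost_iff atLeastLessThan_iff Suc_leI le_SucI)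
  have lt: "a < b" using asc by (simp add: a_def b_def)
  show "(pinv w i, pinv w (Suc i)) \<notin> inversions n w"
    using wa wb by (simp add: inversions_def flip: a_def b_def)
  \<comment> \<open>The transposition \<open>adj i\<close> preserves the order of every pair of values other than \<open>i\<close>, \<open>Suc i\<close>.\<close>
  have key: "adj i (w y) < adj i (w x) \<longleftrightarrow> w y < w x" if "(x, y) \<noteq> (a, b)" "x < y" for x y
  proof -
    have "\<not> (w x = i \<and> w y = Suc i)"
      using that wa wb inj by (metis)
    moreover have "\<not> (w x = Suc i \<and> w y = i)"
      using that wa wb inj lt by (metis less_asym)
    moreover have "w x \<noteq> w y" using that inj by auto
    ultimately show ?thesis
      unfolding transpose_def by auto
  qed
  show "inversions n (adj i \<circ> w) = insert (pinv w i, pinv w (Suc i)) (inversions n w)"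
    unfolding a_def[symmetric] b_def[symmetric]
  proof (rule Set.set_eqI)
    fix z :: "nat \<times> nat"
    obtain x y where z: "z = (x, y)" by (cases z)
    show "(z \<in> inversions n (adj i \<circ> w) \<longleftrightarrow> z \<in> insert (a, b) (inversions n w))"
      unfolding z using key[of x y] ab lt wa wb by (cases "(x, y) = (a, b)") (auto simp: inversions_def)
  qed
qed

lemma adj_adj [simp]: "adj i \<circ> (adj i \<circ> w) = w"
  by (simp add: fun_eq_iff)

lemma pinv_adj_comp: "w permutes {1..n} \<Longrightarrow> pinv (adj i \<circ> w) j = pinv w (adj i j)"
proof -
  assume w: "w permutes {1..n}"
  have "pinv (adj i \<circ> w) = pinv w \<circ> pinv (adj i)"
    using permutes_bij[OF w] by (intro o_inv_distrib) auto
  then show ?thesis by simp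
qed

lemma adj_comp_permutes:
  "w permutes {1..n} \<Longrightarrow> i \<in> {1..<n} \<Longrightarrow> adj i \<circ> w permutes {1..n}"
  by (intro permutes_compose adj_permutes)

lemma card_inversions_ascent:
  assumes "w permutes {1..n}" "i \<in> {1..<n}" "pinv w i < pinv w (Suc i)"
  shows "card (inversions n (adj i \<circ> w)) = Suc (card (inversions n w))"
  using inversions_adj_ascent[OF assms] by simp

lemma card_inversions_descent:
  assumes "w permutes {1..n}" "i \<in> {1..<n}" "pinv w (Suc i) < pinv w i"
  shows "card (inversions n w) = Suc (card (inversions n (adj i \<circ> w)))"
  using card_inversions_ascent[OF adj_comp_permutes[OF assms(1,2)] assms(2)] assms(3)
  by (simp add: pinv_adj_comp[OF assms(1)])

lemma pinv_neq: "w permutes {1..n} \<Longrightarrow> pinv w i = pinv w j \<longleftrightarrow> i = j"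
  using permutes_inj[OF permutes_inv] by (metis injD)

text \<open>Each letter changes the number of inversions by one.\<close>

lemma card_inversions_le_length:
  "set is \<subseteq> {1..<n} \<Longrightarrow> card (inversions n (word_perm is)) \<le> length is"
proof (induction "is")
  case (Cons i "is")
  then have w: "word_perm is permutes {1..n}" and i: "i \<in> {1..<n}"
    using word_perm_permutes by auto
  have "pinv (word_perm is) i < pinv (word_perm is) (Suc i) \<or>
      pinv (word_perm is) (Suc i) < pinv (word_perm is) i"
    using pinv_neq[OF w, of i "Suc i"] by auto
  moreover have "card (inversions n (word_perm is)) \<le> length is"
    using Cons by simp
  ultimately have "card (inversions n (adj i \<circ> word_perm is)) \<le> Suc (length is)"
    using card_inversions_ascent[OF w i] card_inversions_descent[OF w i] by linarith
  then show ?case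
    by (simp only: word_perm_simps list.size add_Suc_right add_0_right)
qed simp

text \<open>An increasing permutation satisfies \<open>i \<le> w i\<close> when counted up from \<open>1\<close> and \<open>w i \<le> i\<close> when counted down
from \<open>n\<close>.\<close>

lemma permutes_increasing_imp_id:
  assumes w: "w permutes {1..n}" and mono: "\<And>i. i \<in> {1..<n} \<Longrightarrow> w i < w (Suc i)"
  shows "w = id"
proof -
  have ge: "i \<le> w i" if "i \<in> {1..n}" for i
    using that
  proof (induction i)
    case (Suc i)
    then show ?case
      using mono[of i] permutes_in_image[OF w, of "Suc i"] by (cases "i = 0") force+
  qed simp
  have le: "w (n - k) \<le> n - k" if "n - k \<in> {1..n}" for k
    using that
  proof (induction k)
    case 0
    then show ?case using permutes_in_image[OF w, of n] by auto
  next
    case (Suc k)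
    then have "w (n - Suc k) < w (Suc (n - Suc k))" by (intro mono) auto
    moreover have "Suc (n - Suc k) = n - k" using Suc.prems by auto
    ultimately show ?case using Suc by auto
  qed
  show ?thesis
  proof
    fix i
    show "w i = id i"
    proof (cases "i \<in> {1..n}")
      case True
      then show ?thesis using ge[of i] le[of "n - i"] by auto
    next
      case False
      then show ?thesis using w by (simp add: permutes_not_in)
    qed
  qed
qed

lemma pinv_pinv: "w permutes {1..n} \<Longrightarrow> pinv (pinv w) = w"
  by (simp add: permutes_inv_inv)

text \<open>As long as \<open>w\<close> is not the identity its inverse has a descent \<open>i\<close>, and \<open>adj i \<circ> w\<close> has one inversion
fewer.\<close>

lemma exists_word_of_card_inversions:
  "w permutes {1..n} \<Longrightarrow>
    \<exists>is. set is \<subseteq> {1..<n} \<and> word_perm is = w \<and> length is = card (inversions n w)"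
proof (induction "card (inversions n w)" arbitrary: w rule: less_induct)
  case less
  show ?case
  proof (cases "\<forall>i\<in>{1..<n}. pinv w i < pinv w (Suc i)")
    case True
    then have "pinv w = id"
      using permutes_increasing_imp_id[OF permutes_inv[OF less.prems]] by auto
    then have "w = id"
      using pinv_pinv[OF less.prems] by (metis inv_id)
    then show ?thesis by (intro exI[of _ "[]"]) simp
  next
    case False
    then obtain i where i: "i \<in> {1..<n}" "\<not> pinv w i < pinv w (Suc i)" by blast
    then have desc: "pinv w (Suc i) < pinv w i"
      using pinv_neq[OF less.prems, of i "Suc i"] by auto
    note c = card_inversions_descent[OF less.prems i(1) desc]
    from less.hyps[of "adj i \<circ> w"] c obtain js where
      "set js \<subseteq> {1..<n}" "word_perm js = adj i \<circ> w" "length js = card (inversions n (adj i \<circ> w))"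
      using adj_comp_permutes[OF less.prems i(1)] by auto
    then show ?thesis using c i(1) by (intro exI[of _ "i # js"]) simp
  qed
qed

lemma cox_length_eq_card_inversions:
  assumes "w permutes {1..n}"
  shows "cox_length n w = card (inversions n w)"
  unfolding cox_length_def
proof (rule Least_equality)
  show "\<exists>is. set is \<subseteq> {1..<n} \<and> word_perm is = w \<and> length is = card (inversions n w)"
    by (rule exists_word_of_card_inversions[OF assms])
qed (use card_inversions_le_length in blast)

lemma exists_reduced_expr: "w permutes {1..n} \<Longrightarrow> \<exists>is. reduced_expr n w is"
  unfolding reduced_expr_def using exists_word_of_card_inversions cox_length_eq_card_inversions
  by metis

lemma reduced_expr_iff:
  "reduced_expr n w is \<longleftrightarrow>
    set is \<subseteq> {1..<n} \<and> word_perm is = w \<and> length is = card (inversions n w)"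
  unfolding reduced_expr_def
  by (metis cox_length_eq_card_inversions word_perm_permutes)

lemma reduced_expr_permutes: "reduced_expr n w is \<Longrightarrow> w permutes {1..n}"
  using word_perm_permutes unfolding reduced_expr_def by blast

lemma reduced_expr_ConsI:
  assumes "w permutes {1..n}" "i \<in> {1..<n}" "pinv w (Suc i) < pinv w i"
    and "reduced_expr n (adj i \<circ> w) is"
  shows "reduced_expr n w (i # is)"
  using assms card_inversions_descent[OF assms(1-3)] by (auto simp: reduced_expr_iff)

lemma reduced_expr_ConsD:
  assumes "reduced_expr n w (i # is)"
  shows "i \<in> {1..<n}" "reduced_expr n (adj i \<circ> w) is" "pinv w (Suc i) < pinv w i"
proof -
  have w: "w permutes {1..n}" using assms reduced_expr_permutes by blast
  show i: "i \<in> {1..<n}" using assms by (simp add: reduced_expr_def)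
  have r: "set is \<subseteq> {1..<n}" "adj i \<circ> word_perm is = w" "Suc (length is) = card (inversions n w)"
    using assms by (auto simp: reduced_expr_iff)
  have u: "word_perm is = adj i \<circ> w" using r(2) by auto
  have le: "card (inversions n (adj i \<circ> w)) \<le> length is"
    using card_inversions_le_length[OF r(1)] u by simp
  have "\<not> pinv w i < pinv w (Suc i)"
    using card_inversions_ascent[OF w i] le r(3) by linarith
  then show d: "pinv w (Suc i) < pinv w i"
    using pinv_neq[OF w, of i "Suc i"] by auto
  show "reduced_expr n (adj i \<circ> w) is"
    using card_inversions_descent[OF w i d] r u by (simp add: reduced_expr_iff)
qed

text \<open>Reduced expressions of the same permutation act in the same way as soon as the operators satisfy the
braid relations. If two such expressions begin with different letters \<open>i\<close> and \<open>j\<close>, then both are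
descents of the inverse permutation. Consequently there are reduced expressions that begin with
\<open>i, j\<close> and \<open>j, i\<close>, or with \<open>i, j, i\<close> and \<open>j, i, j\<close>, and continue alike, and the induction
hypothesis connects these to the given ones.\<close>

theorem matsumoto:
  fixes op :: "nat \<Rightarrow> 'b \<Rightarrow> 'b"
  assumes comm: "\<And>i j x. i \<in> {1..<n} \<Longrightarrow> j \<in> {1..<n} \<Longrightarrow> Suc i < j \<Longrightarrow>
      op i (op j x) = op j (op i x)"
    and braid: "\<And>i x. i \<in> {1..<n} \<Longrightarrow> Suc i \<in> {1..<n} \<Longrightarrow>
      op i (op (Suc i) (op i x)) = op (Suc i) (op i (op (Suc i) x))"
    and red: "reduced_expr n w is" "reduced_expr n w js"
  shows "foldr op is x = foldr op js x"
  using red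
proof (induction "length is" arbitrary: w "is" js rule: less_induct)
  case less
  note w = reduced_expr_permutes[OF less.prems(1)]
  have len: "length is = length js"
    using less.prems by (simp add: reduced_expr_def)
  show ?case
  proof (cases "is")
    case Nil
    then show ?thesis using len by simp
  next
    case (Cons i us)
    with len obtain j vs where js: "js = j # vs" by (cases js) auto
    note ri = reduced_expr_ConsD[OF less.prems(1)[unfolded Cons]]
    note rj = reduced_expr_ConsD[OF less.prems(2)[unfolded js]]
    \<comment> \<open>Words with the same first letter agree by induction, so the first letters may be followed
      by any reduced continuation.\<close>
    have same: "foldr op (i # us) x = foldr op (i # us') x" if "reduced_expr n w (i # us')" for us'
      using less.hyps[of us, OF _ ri(2)] reduced_expr_ConsD(2)[OF that] Cons by simp
    have same': "foldr op (j # vs) x = foldr op (j # vs') x" if "reduced_expr n w (j # vs')" for vs'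
      using less.hyps[of vs, OF _ rj(2)] reduced_expr_ConsD(2)[OF that] Cons js len by simp
    have key: "\<exists>us' vs'. reduced_expr n w (i # us') \<and> reduced_expr n w (j # vs') \<and>
        foldr op (i # us') x = foldr op (j # vs') x"
      if ij: "i < j" "i \<in> {1..<n}" "j \<in> {1..<n}"
        "pinv w (Suc i) < pinv w i" "pinv w (Suc j) < pinv w j" for i j
    proof (cases "Suc i = j")
      case False
      have far: "adj i j = j" "adj i (Suc j) = Suc j" "adj j i = i" "adj j (Suc i) = Suc i"
        using ij False by (auto simp: transpose_def)
      define w' where "w' = adj j \<circ> (adj i \<circ> w)"
      have w'_alt: "w' = adj i \<circ> (adj j \<circ> w)"
        using ij False by (auto simp: w'_def transpose_def fun_eq_iff)
      note pw = adj_comp_permutes[OF w ij(2)] adj_comp_permutes[OF w ij(3)]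
      obtain ts where ts: "reduced_expr n w' ts"
        using exists_reduced_expr adj_comp_permutes[OF pw(1) ij(3)] unfolding w'_def by blast
      have "reduced_expr n w (i # j # ts)"
        using ts ij far unfolding w'_def
        by (intro reduced_expr_ConsI[OF w ij(2)] reduced_expr_ConsI[OF pw(1) ij(3)])
          (simp_all add: pinv_adj_comp[OF w])
      moreover have "reduced_expr n w (j # i # ts)"
        using ts ij far unfolding w'_alt
        by (intro reduced_expr_ConsI[OF w ij(3)] reduced_expr_ConsI[OF pw(2) ij(2)])
          (simp_all add: pinv_adj_comp[OF w])
      ultimately show ?thesis
        using comm[of i j] ij False by (intro exI[of _ "j # ts"] exI[of _ "i # ts"]) simp
    next
      case True
      define w' where "w' = adj i \<circ> (adj j \<circ> (adj i \<circ> w))"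
      have w'_alt: "w' = adj j \<circ> (adj i \<circ> (adj j \<circ> w))"
        using True by (auto simp: w'_def transpose_def fun_eq_iff)
      note pw = adj_comp_permutes[OF w ij(2)] adj_comp_permutes[OF w ij(3)]
      note pw2 = adj_comp_permutes[OF pw(1) ij(3)] adj_comp_permutes[OF pw(2) ij(2)]
      obtain ts where ts: "reduced_expr n w' ts"
        using exists_reduced_expr adj_comp_permutes[OF pw2(1) ij(2)] unfolding w'_def by blast
      have far: "adj i j = i" "adj i (Suc j) = Suc j" "adj j i = i" "adj j (Suc j) = j"
          "adj j j = Suc j" "adj i i = Suc i" "adj j (Suc i) = Suc j"
        using True by (auto simp: transpose_def)
      have lt: "pinv w j < pinv w i" "pinv w (Suc j) < pinv w (Suc i)" "pinv w (Suc j) < pinv w i"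
        using ij True by auto
      have "reduced_expr n w (i # j # i # ts)"
      proof (intro reduced_expr_ConsI[OF w ij(2)] reduced_expr_ConsI[OF pw(1) ij(3)]
          reduced_expr_ConsI[OF pw2(1) ij(2)])
        show "reduced_expr n (adj i \<circ> (adj j \<circ> (adj i \<circ> w))) ts"
          using ts unfolding w'_def .
      qed (use lt ij(4,5) in \<open>simp_all only: pinv_adj_comp[OF w] pinv_adj_comp[OF pw(1)] far\<close>)
      moreover have "reduced_expr n w (j # i # j # ts)"
      proof (intro reduced_expr_ConsI[OF w ij(3)] reduced_expr_ConsI[OF pw(2) ij(2)]
          reduced_expr_ConsI[OF pw2(2) ij(3)])
        show "reduced_expr n (adj j \<circ> (adj i \<circ> (adj j \<circ> w))) ts"
          using ts unfolding w'_alt .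
      qed (use lt ij(4,5) in \<open>simp_all only: pinv_adj_comp[OF w] pinv_adj_comp[OF pw(2)] far\<close>)
      ultimately show ?thesis
        using braid[of i] ij True
        by (intro exI[of _ "j # i # ts"] exI[of _ "i # j # ts"]) auto
    qed
    consider "i = j" | "i < j" | "j < i" by linarith
    then show ?thesis
    proof cases
      case 1
      then show ?thesis using same[of vs] less.prems(2) Cons js by simp
    next
      case 2
      then show ?thesis using key[of i j] ri rj same same' Cons js by metis
    next
      case 3
      then show ?thesis using key[of j i] ri rj same same' Cons js by metis
    qed
  qed
qed

section \<open>The longest permutation\<close>

definition reversal :: "nat \<Rightarrow> nat \<Rightarrow> nat"
  where "reversal n a = (if a \<in> {1..n} then Suc n - a else a)"

text \<open>The concatenation of the blocks \<open>n-1, \<dots>, j\<close> for \<open>j = k, \<dots>, n-1\<close>. For \<open>k = 1\<close> it is the reduced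
expression of the longest permutation along which the antisymmetrization is computed below.\<close>

definition staircase_word :: "nat \<Rightarrow> nat \<Rightarrow> nat list"
  where "staircase_word n k = concat (map (\<lambda>j. rev [j..<n]) [k..<n])"

lemma staircase_word_rec:
  "k < n \<Longrightarrow> staircase_word n k = rev [k..<n] @ staircase_word n (Suc k)"
  by (simp add: staircase_word_def upt_conv_Cons)

lemma set_staircase_word: "set (staircase_word n k) \<subseteq> {k..<n}"
  by (auto simp: staircase_word_def)

text \<open>A block is a cycle that moves \<open>k\<close> up to \<open>i\<close> and every value in between one step down.\<close>

lemma word_perm_rev_upt:
  assumes "k \<le> i"
  shows "word_perm (rev [k..<i]) a = (if a = k then i else if a \<in> {k<..i} then a - 1 else a)"
  using assms
proof (induction i rule: dec_induct)
  case (step i)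
  then have "word_perm (rev [k..<Suc i]) a = adj i (word_perm (rev [k..<i]) a)"
    by simp
  also have "\<dots> = (if a = k then Suc i else if a \<in> {k<..Suc i} then a - 1 else a)"
    using step.hyps unfolding step.IH transpose_def by auto
  finally show ?case .
qed auto

text \<open>The parameter \<open>k\<close> makes the induction possible: the word reverses the interval \<open>{k..n}\<close>.\<close>

lemma word_perm_staircase_word:
  "k \<le> n \<Longrightarrow> word_perm (staircase_word n k) a = (if a \<in> {k..n} then n + k - a else a)"
proof (induction k rule: inc_induct)
  case base
  then show ?case by (auto simp: staircase_word_def)
next
  case (step k)
  have "word_perm (staircase_word n k) a =
      word_perm (rev [k..<n]) (word_perm (staircase_word n (Suc k)) a)"
    using step.hyps by (simp only: staircase_word_rec word_perm_append o_apply)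
  also have "\<dots> = (if a \<in> {k..n} then n + k - a else a)"
    using step.hyps unfolding step.IH word_perm_rev_upt[OF less_imp_le[OF step.hyps(2)]] by auto
  finally show ?case .
qed

lemma length_staircase_word: "length (staircase_word n 1) = n * (n - 1) div 2"
proof -
  have "length (staircase_word n 1) = (\<Sum>j\<leftarrow>[1..<n]. n - j)"
    by (simp add: staircase_word_def length_concat o_def)
  also have "\<dots> = (\<Sum>j = 1..<n. n - j)"
    by (simp add: interv_sum_list_conv_sum_set_nat)
  also have "\<dots> = (\<Sum>i = 1..<n. i)"
    by (rule sum.reindex_bij_witness[of _ "\<lambda>i. n - i" "\<lambda>i. n - i"]) auto
  also have "\<dots> = (\<Sum>i = 0..<n. i)"
    by (rule sum.mono_neutral_left) auto
  also have "\<dots> = n * (n - 1) div 2"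
    by (simp add: Sum_Ico_nat)
  finally show ?thesis .
qed

lemma inversions_subset: "inversions n w \<subseteq> (SIGMA a:{1..n}. {a<..n})"
  by (auto simp: inversions_def)

lemma inversions_reversal: "inversions n (reversal n) = (SIGMA a:{1..n}. {a<..n})"
  by (auto simp: inversions_def reversal_def)

lemma card_inversions_reversal: "card (inversions n (reversal n)) = n * (n - 1) div 2"
proof -
  have "card (inversions n (reversal n)) = (\<Sum>a = 1..n. n - a)"
    by (simp add: inversions_reversal)
  also have "\<dots> = (\<Sum>i = 0..<n. i)"
    by (rule sum.reindex_bij_witness[of _ "\<lambda>i. n - i" "\<lambda>i. n - i"]) auto
  also have "\<dots> = n * (n - 1) div 2"
    by (simp add: Sum_Ico_nat)
  finally show ?thesis .
qed

lemma word_perm_staircase_word_1: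
  "n \<ge> 1 \<Longrightarrow> word_perm (staircase_word n 1) = reversal n"
  by (rule ext) (simp add: word_perm_staircase_word reversal_def)

lemma reversal_permutes: "reversal n permutes {1..n}"
proof (cases "n = 0")
  case True
  then show ?thesis by (auto simp: reversal_def permutes_def)
next
  case False
  then show ?thesis
    using word_perm_staircase_word_1[of n] word_perm_permutes[OF set_staircase_word[of n 1]] by (simp del: One_nat_def)
qed

lemma reversal_reversal [simp]: "reversal n \<circ> reversal n = id"
  by (auto simp: reversal_def fun_eq_iff)

lemma pinv_reversal [simp]: "pinv (reversal n) = reversal n"
  by (rule inv_equality) (simp_all add: pointfree_idE[OF reversal_reversal])

text \<open>If all pairs are inverted, then \<open>w\<close> is decreasing, and its composition with the reversal is increasing.\<close>

lemma eq_reversal_if_inversions_maximal: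
  assumes w: "w permutes {1..n}" and max: "inversions n w = (SIGMA a:{1..n}. {a<..n})"
  shows "w = reversal n"
proof -
  have "reversal n \<circ> w = id"
  proof (rule permutes_increasing_imp_id)
    show "reversal n \<circ> w permutes {1..n}"
      by (rule permutes_compose[OF w reversal_permutes])
    fix i assume i: "i \<in> {1..<n}"
    then have "(i, Suc i) \<in> inversions n w" by (auto simp: max)
    then have "w (Suc i) < w i" by (simp add: inversions_def)
    then show "(reversal n \<circ> w) i < (reversal n \<circ> w) (Suc i)"
      using permutes_in_image[OF w, of i] permutes_in_image[OF w, of "Suc i"] i
      by (auto simp: reversal_def)
  qed
  then have "reversal n \<circ> (reversal n \<circ> w) = reversal n" by simp
  then show ?thesis by (simp only: o_assoc reversal_reversal id_comp)
qed

lemma longest_perm_eq_reversal: "longest_perm n = reversal n"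
  unfolding longest_perm_def
proof (rule the_equality)
  have fin: "finite (SIGMA a:{1..n}. {a<..n})" by auto
  show "reversal n permutes {1..n} \<and>
      (\<forall>v. v permutes {1..n} \<longrightarrow> cox_length n v \<le> cox_length n (reversal n))"
    using card_mono[OF fin inversions_subset] reversal_permutes
    by (simp add: cox_length_eq_card_inversions inversions_reversal)
  fix w assume w: "w permutes {1..n} \<and>
      (\<forall>v. v permutes {1..n} \<longrightarrow> cox_length n v \<le> cox_length n w)"
  then have "card (inversions n (reversal n)) \<le> card (inversions n w)"
    using reversal_permutes by (auto simp: cox_length_eq_card_inversions)
  then show "w = reversal n"
    using w card_seteq[OF fin inversions_subset[of n w]]
    by (intro eq_reversal_if_inversions_maximal) (auto simp: inversions_reversal)
qed

lemma reduced_staircase_word: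
  "n \<ge> 1 \<Longrightarrow> reduced_expr n (longest_perm n) (staircase_word n 1)"
  using set_staircase_word[of n 1]
  by (simp add: reduced_expr_iff longest_perm_eq_reversal word_perm_staircase_word_1
      length_staircase_word card_inversions_reversal del: One_nat_def)

lemma length_reduced_expr_longest:
  "reduced_expr n (longest_perm n) is \<Longrightarrow> length is = n * (n - 1) div 2"
  by (simp add: reduced_expr_iff longest_perm_eq_reversal card_inversions_reversal)

text \<open>The longest permutation is decreasing and its own inverse, so every \<open>i\<close> is a descent. Its operator on
polynomials can therefore be written with \<open>divided_diff i\<close> applied last, which makes its values
symmetric.\<close>

lemma exists_reduced_expr_longest_Cons:
  assumes i: "i \<in> {1..<n}"
  shows "\<exists>is. reduced_expr n (longest_perm n) (i # is)"
proof -
  have w: "longest_perm n permutes {1..n}"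
    by (simp add: longest_perm_eq_reversal reversal_permutes del: One_nat_def)
  obtain "is" where "reduced_expr n (adj i \<circ> longest_perm n) is"
    using exists_reduced_expr[OF adj_comp_permutes[OF w i]] by blast
  moreover have "pinv (longest_perm n) (Suc i) < pinv (longest_perm n) i"
    using i unfolding longest_perm_eq_reversal pinv_reversal by (auto simp: reversal_def)
  ultimately show ?thesis
    using reduced_expr_ConsI[OF w i] by blast
qed

lemma word_perm_rev_comp: "word_perm (rev is) \<circ> word_perm is = id"
proof (induction "is")
  case (Cons i "is")
  have "word_perm (rev (i # is)) \<circ> word_perm (i # is) =
      word_perm (rev is) \<circ> (adj i \<circ> (adj i \<circ> word_perm is))"
    by (simp add: word_perm_append fun_eq_iff)
  then show ?case using Cons by (simp only: adj_adj)
qed simp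

text \<open>The longest permutation is an involution, and reversing a word inverts its permutation.\<close>

lemma reduced_expr_longest_rev:
  assumes red: "reduced_expr n (longest_perm n) is"
  shows "reduced_expr n (longest_perm n) (rev is)"
proof -
  let ?r = "reversal n"
  have r: "word_perm is = ?r"
    using red by (simp add: reduced_expr_def longest_perm_eq_reversal)
  have "word_perm (rev is) \<circ> (?r \<circ> ?r) = ?r"
    using word_perm_rev_comp[of "is"] unfolding r o_assoc by simp
  then have "word_perm (rev is) = ?r"
    by (simp only: reversal_reversal comp_id)
  then show ?thesis
    using red by (simp add: reduced_expr_def longest_perm_eq_reversal)
qed

lemma sign_word_perm: "set is \<subseteq> {1..<n} \<Longrightarrow> sign (word_perm is) = (- 1) ^ length is"
proof (induction "is")
  case (Cons i "is")
  have "permutation (word_perm is)" "permutation (adj i)"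
    using Cons.prems word_perm_permutes[of "is" n] adj_permutes[of i n]
    by (auto simp: permutation_permutes intro!: exI[of _ "{1..n}"])
  then have "sign (adj i \<circ> word_perm is) = - sign (word_perm is)"
    by (simp add: sign_compose sign_swap_id)
  then show ?case using Cons by (simp only: word_perm_simps) simp
qed simp

text \<open>Makes the multiplicativity of the sign available for \<open>cox_length\<close>.\<close>

lemma minus_one_power_cox_length:
  assumes "w permutes {1..n}"
  shows "(- 1) ^ cox_length n w = (of_int (sign w) :: 'b :: ring_1)"
proof -
  obtain "is" where "reduced_expr n w is" using exists_reduced_expr[OF assms] by blast
  then show ?thesis
    using sign_word_perm[of "is" n] by (auto simp: reduced_expr_def)
qed

section \<open>Polynomials and divided differences\<close>

lemma poly_mapping_sum_singles:
  fixes a :: "'b \<Rightarrow>\<^sub>0 'c::comm_monoid_add"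
  shows "a = (\<Sum>k\<in>Poly_Mapping.keys a. Poly_Mapping.single k (Poly_Mapping.lookup a k))"
proof (rule poly_mapping_eqI)
  fix k
  have "(\<Sum>k'\<in>Poly_Mapping.keys a. Poly_Mapping.lookup a k' when k' = k) = Poly_Mapping.lookup a k"
    by (cases "k \<in> Poly_Mapping.keys a") (auto simp: when_def in_keys_iff)
  then show "Poly_Mapping.lookup a k = Poly_Mapping.lookup
      (\<Sum>k\<in>Poly_Mapping.keys a. Poly_Mapping.single k (Poly_Mapping.lookup a k)) k"
    by (simp add: lookup_sum lookup_single)
qed

lemma poly_mapping_single_induct [case_names zero single add]:
  fixes a :: "'b \<Rightarrow>\<^sub>0 'c::comm_monoid_add"
  assumes "P 0" and "\<And>k c. k \<in> Poly_Mapping.keys a \<Longrightarrow> P (Poly_Mapping.single k c)"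
    and "\<And>x y. P x \<Longrightarrow> P y \<Longrightarrow> P (x + y)"
  shows "P a"
proof -
  have "finite A \<Longrightarrow> A \<subseteq> Poly_Mapping.keys a \<Longrightarrow>
      P (\<Sum>k\<in>A. Poly_Mapping.single k (Poly_Mapping.lookup a k))" for A
    by (induction A rule: finite_induct) (auto intro: assms)
  from this[of "Poly_Mapping.keys a"] show ?thesis
    using poly_mapping_sum_singles[of a] by simp
qed

definition polys :: "nat set \<Rightarrow> 'a::field mpoly set"
  where "polys V = {p. \<forall>m\<in>Poly_Mapping.keys p. Poly_Mapping.keys m \<subseteq> V}"

lemma polys_UNIV [simp]: "p \<in> polys UNIV"
  by (simp add: polys_def)

lemma PConst_mult: "PConst c * PConst d = PConst (c * d)"
  by (simp add: PConst_def mult_single)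

lemma PConst_1 [simp]: "PConst 1 = 1"
  by (simp add: PConst_def)

lemma PConst_0 [simp]: "PConst 0 = 0"
  by (simp add: PConst_def)

lemma PConst_mult_single:
  "PConst c * Poly_Mapping.single m d = Poly_Mapping.single m (c * d)"
  by (simp add: PConst_def mult_single)

lemma PVar_mult_single:
  "PVar k * Poly_Mapping.single m c = Poly_Mapping.single (Poly_Mapping.single k 1 + m) c"
  by (simp add: PVar_def mult_single)

lemma polys_single: "Poly_Mapping.keys m \<subseteq> V \<Longrightarrow> Poly_Mapping.single m c \<in> polys V"
  by (simp add: polys_def)

lemma polys_PConst [simp]: "PConst c \<in> polys V"
  by (simp add: PConst_def polys_def)

lemma polys_1 [simp]: "1 \<in> polys V"
  using polys_PConst[of 1 V] by simp

lemma polys_0 [simp]: "0 \<in> polys V"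
  by (simp add: polys_def)

lemma polys_PVar: "k \<in> V \<Longrightarrow> PVar k \<in> polys V"
  by (simp add: PVar_def polys_def)

lemma polys_add: "p \<in> polys V \<Longrightarrow> q \<in> polys V \<Longrightarrow> p + q \<in> polys V"
  using keys_add[of p q] unfolding polys_def by blast

lemma polys_mult:
  assumes "p \<in> polys V" "q \<in> polys V"
  shows "p * q \<in> polys V"
  unfolding polys_def
proof clarify
  fix m k assume "m \<in> Poly_Mapping.keys (p * q)" "k \<in> Poly_Mapping.keys m"
  then obtain a b where "a \<in> Poly_Mapping.keys p" "b \<in> Poly_Mapping.keys q" "k \<in> Poly_Mapping.keys (a + b)"
    using keys_mult[of p q] by blast
  then show "k \<in> V"
    using assms keys_add[of a b] unfolding polys_def by blast
qed

lemma PConst_uminus: "PConst (- c) = - PConst c"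
  by (simp add: PConst_def single_uminus)

lemma polys_uminus: "p \<in> polys V \<Longrightarrow> - p \<in> polys V"
  using polys_mult[OF polys_PConst[of "- 1" V]] by (simp add: PConst_uminus)

lemma polys_diff: "p \<in> polys V \<Longrightarrow> q \<in> polys V \<Longrightarrow> p - q \<in> polys V"
  using polys_add[of p V "- q"] by (simp add: polys_uminus)

text \<open>Polynomials are generated from constants by multiplication with variables and addition. Since only
multiplication with one variable at a time has to be checked, the twisted Leibniz rule is all that
is required of a divided difference in such an induction.\<close>

lemma polys_induct [consumes 1, case_names const var add]:
  assumes p: "p \<in> polys V"
    and const: "\<And>c. P (PConst c)"
    and var: "\<And>k q. k \<in> V \<Longrightarrow> q \<in> polys V \<Longrightarrow> P q \<Longrightarrow> P (PVar k * q)"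
    and add: "\<And>q r. P q \<Longrightarrow> P r \<Longrightarrow> P (q + r)"
  shows "P p"
proof -
  have power: "P (Poly_Mapping.single (Poly_Mapping.single k e + m) c)"
    if "k \<in> V" "Poly_Mapping.keys m \<subseteq> V" "P (Poly_Mapping.single m c)" for k e m c
  proof (induction e)
    case 0
    then show ?case using that by simp
  next
    case (Suc e)
    have "Poly_Mapping.keys (Poly_Mapping.single k e + m) \<subseteq> V"
      using keys_add[of "Poly_Mapping.single k e" m] that by (auto split: if_splits)
    then have "P (PVar k * Poly_Mapping.single (Poly_Mapping.single k e + m) c)"
      by (intro var that polys_single Suc)
    then show ?case
      by (simp add: PVar_mult_single flip: add.assoc single_add)
  qed
  have monom: "P (Poly_Mapping.single m c)" if "Poly_Mapping.keys m \<subseteq> V" for m c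
  proof -
    have "finite A \<Longrightarrow> A \<subseteq> V \<Longrightarrow>
        Poly_Mapping.keys (\<Sum>k\<in>A. Poly_Mapping.single k (Poly_Mapping.lookup m k)) \<subseteq> V \<and>
        P (Poly_Mapping.single (\<Sum>k\<in>A. Poly_Mapping.single k (Poly_Mapping.lookup m k)) c)" for A
    proof (induction A rule: finite_induct)
      case empty
      then show ?case using const[of c] by (simp add: PConst_def)
    next
      case (insert k A)
      then show ?case
        using keys_add[of "Poly_Mapping.single k (Poly_Mapping.lookup m k)"
            "\<Sum>k\<in>A. Poly_Mapping.single k (Poly_Mapping.lookup m k)"]
        by (auto intro!: power split: if_splits)
    qed
    from this[of "Poly_Mapping.keys m"] show ?thesis
      using that by (simp flip: poly_mapping_sum_singles)
  qed
  show ?thesis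
  proof (rule poly_mapping_single_induct[of P p])
    show "P 0" using const[of 0] by simp
    show "P (Poly_Mapping.single m c)" if "m \<in> Poly_Mapping.keys p" for m c
      using that p by (intro monom) (simp add: polys_def)
  qed (rule add)
qed

text \<open>The coefficient at \<open>m\<close> of the result is that at \<open>m \<circ> w\<close> of the argument; thus \<open>PVar k\<close> goes
to \<open>PVar (w k)\<close>, and \<open>perm_vars\<close> is a left action.\<close>

definition perm_vars :: "(nat \<Rightarrow> nat) \<Rightarrow> 'a::field mpoly \<Rightarrow> 'a mpoly"
  where "perm_vars w = Poly_Mapping.map_key (Poly_Mapping.map_key w)"

lemma swap_vars_eq: "swap_vars i = perm_vars (adj i)"
  by (simp add: swap_vars_def perm_vars_def)

context
  fixes w :: "nat \<Rightarrow> nat"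
  assumes w: "bij w"
begin

lemma map_key_inverses:
  "Poly_Mapping.map_key w (Poly_Mapping.map_key (pinv w) m) = m"
  "Poly_Mapping.map_key (pinv w) (Poly_Mapping.map_key w m) = m"
proof -
  have i: "inj w" "inj (pinv w)" "pinv w \<circ> w = (\<lambda>x. x)" "w \<circ> pinv w = (\<lambda>x. x)"
    using w bij_is_inj bij_imp_bij_inv
    by (auto simp: fun_eq_iff bij_is_inj bij_is_surj surj_f_inv_f)
  show "Poly_Mapping.map_key w (Poly_Mapping.map_key (pinv w) m) = m"
    "Poly_Mapping.map_key (pinv w) (Poly_Mapping.map_key w m) = m"
    using map_key_compose[OF i(1,2), of m] map_key_compose[OF i(2,1), of m] i(3,4)
    by (simp_all add: map_key_id)
qed

lemma inj_map_key: "inj (Poly_Mapping.map_key w :: (nat \<Rightarrow>\<^sub>0 nat) \<Rightarrow> _)"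
  by (rule inj_on_inverseI[of _ "Poly_Mapping.map_key (pinv w)"]) (simp add: map_key_inverses)

lemma perm_vars_single:
  "perm_vars w (Poly_Mapping.single m c) =
    Poly_Mapping.single (Poly_Mapping.map_key (pinv w) m) c"
  using map_key_single[OF inj_map_key, of "Poly_Mapping.map_key (pinv w) m" c]
  by (simp add: perm_vars_def map_key_inverses)

lemma perm_vars_add: "perm_vars w (p + q) = perm_vars w p + perm_vars w q"
  by (simp add: perm_vars_def map_key_plus[OF inj_map_key])

lemma perm_vars_PConst [simp]: "perm_vars w (PConst c) = PConst c"
  using w by (simp add: PConst_def perm_vars_single bij_imp_bij_inv bij_is_inj)

lemma perm_vars_PVar [simp]: "perm_vars w (PVar k) = PVar (w k)"
proof -
  have "Poly_Mapping.map_key (pinv w) (Poly_Mapping.single (pinv w (w k)) 1) =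
      Poly_Mapping.single (w k) (1 :: nat)"
    using w by (intro map_key_single) (simp add: bij_imp_bij_inv bij_is_inj)
  then show ?thesis
    using w by (simp add: PVar_def perm_vars_single bij_is_inj)
qed

lemma perm_vars_0 [simp]: "perm_vars w 0 = 0"
  using perm_vars_PConst[of 0] by simp

lemma perm_vars_1 [simp]: "perm_vars w 1 = 1"
  using perm_vars_PConst[of 1] by simp

lemma perm_vars_mult: "perm_vars w (p * q) = perm_vars w p * perm_vars w q"
proof -
  have inj: "inj (pinv w)" using w by (simp add: bij_imp_bij_inv bij_is_inj)
  have monom: "perm_vars w (Poly_Mapping.single m c * q) =
      perm_vars w (Poly_Mapping.single m c) * perm_vars w q" for m c
    by (induction q rule: poly_mapping_single_induct)
      (auto simp: mult_single perm_vars_single perm_vars_add distrib_left map_key_plus[OF inj])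
  show ?thesis
    by (induction p rule: poly_mapping_single_induct)
      (auto simp: monom perm_vars_add distrib_right)
qed

lemma perm_vars_uminus: "perm_vars w (- p) = - perm_vars w p"
  using perm_vars_mult[of "PConst (- 1)" p] unfolding perm_vars_PConst by (simp add: PConst_uminus)

lemma perm_vars_diff: "perm_vars w (p - q) = perm_vars w p - perm_vars w q"
  using perm_vars_add[of p "- q"] by (simp add: perm_vars_uminus)

lemma perm_vars_power: "perm_vars w (p ^ k) = perm_vars w p ^ k"
  by (induction k) (simp_all add: perm_vars_mult)

lemma perm_vars_prod: "perm_vars w (\<Prod>k\<in>A. f k) = (\<Prod>k\<in>A. perm_vars w (f k))"
  by (induction A rule: infinite_finite_induct) (simp_all add: perm_vars_mult)

lemma perm_vars_sum: "perm_vars w (\<Sum>k\<in>A. f k) = (\<Sum>k\<in>A. perm_vars w (f k))"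
  by (induction A rule: infinite_finite_induct) (simp_all add: perm_vars_add)

lemmas perm_vars_hom = perm_vars_add perm_vars_mult perm_vars_uminus perm_vars_diff
  perm_vars_power perm_vars_prod perm_vars_sum

end

lemma perm_vars_comp:
  assumes "bij v" "bij w"
  shows "perm_vars v (perm_vars w p) = perm_vars (v \<circ> w) p"
  using polys_UNIV[of p] assms
  by (induction p rule: polys_induct) (simp_all add: perm_vars_hom bij_comp del: polys_UNIV)

lemma perm_vars_ident [simp]: "perm_vars (\<lambda>x. x) p = p"
proof -
  have b: "bij (\<lambda>x :: nat. x)" using bij_id by (simp add: id_def)
  show ?thesis
    using polys_UNIV[of p]
    by (induction p rule: polys_induct)
      (simp_all only: perm_vars_hom[OF b] perm_vars_PConst[OF b] perm_vars_PVar[OF b])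
qed

lemma perm_vars_id [simp]: "perm_vars id p = p"
  unfolding id_def by simp

abbreviation swp :: "nat \<Rightarrow> 'a::field mpoly \<Rightarrow> 'a mpoly"
  where "swp i \<equiv> perm_vars (adj i)"

lemma swp_swp [simp]: "swp i (swp i p) = p"
  by (simp add: perm_vars_comp)

lemma PVar_eq_iff [simp]: "PVar i = PVar j \<longleftrightarrow> i = j"
proof
  assume "(PVar i :: 'a mpoly) = PVar j"
  from arg_cong[OF this, of Poly_Mapping.keys]
  have "Poly_Mapping.single i (1 :: nat) = Poly_Mapping.single j 1"
    by (simp add: PVar_def)
  from arg_cong[OF this, of Poly_Mapping.keys] show "i = j" by simp
qed simp

text \<open>The class of polynomials for which the division is possible is closed under multiplication with a
variable \<open>x\<close>, because \<open>x q - s (x q) = x (q - s q) + (x - s x) (s q)\<close> and \<open>x - s x\<close> is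
\<open>0\<close> or plus or minus the divisor.\<close>

lemma divided_diff_exists:
  fixes p :: "'a::field mpoly"
  shows "\<exists>d. d * (PVar (Suc i) - PVar i) = p - swp i p"
  using polys_UNIV[of p]
proof (induction p rule: polys_induct)
  case (const c)
  then show ?case by (intro exI[of _ 0]) simp
next
  case (var k q)
  then obtain d where d: "d * (PVar (Suc i) - PVar i) = q - swp i q" by blast
  obtain e :: "'a mpoly" where e: "e * (PVar (Suc i) - PVar i) = PVar k - swp i (PVar k)"
  proof -
    consider "k = i" | "k = Suc i" | "k \<noteq> i" "k \<noteq> Suc i" by blast
    then show thesis
    proof cases
      case 1
      then show ?thesis by (intro that[of "- 1"]) simp
    next
      case 2
      then show ?thesis by (intro that[of 1]) simp
    next
      case 3
      then show ?thesis by (intro that[of 0]) simp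
    qed
  qed
  have "(PVar k * d + e * swp i q) * (PVar (Suc i) - PVar i) =
      PVar k * (d * (PVar (Suc i) - PVar i)) + e * (PVar (Suc i) - PVar i) * swp i q"
    by (simp add: algebra_simps)
  also have "\<dots> = PVar k * q - swp i (PVar k * q)"
    unfolding d e by (simp add: perm_vars_mult algebra_simps)
  finally show ?case by blast
next
  case (add q r)
  then obtain d e where "d * (PVar (Suc i) - PVar i) = q - swp i q"
    "e * (PVar (Suc i) - PVar i) = r - swp i r" by blast
  then have "(d + e) * (PVar (Suc i) - PVar i) = q + r - swp i (q + r)"
    by (simp add: distrib_right perm_vars_add)
  then show ?case by blast
qed

lemma PVar_diff_nonzero: "PVar (Suc i) - PVar i \<noteq> 0"
  by simp

text \<open>Polynomials form an integral domain, so any quotient found by hand is the quotient.\<close>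

lemma divided_diff_eqI:
  "d * (PVar (Suc i) - PVar i) = p - swp i p \<Longrightarrow> divided_diff i p = d"
  unfolding divided_diff_def exact_quot_def swap_vars_eq
  by (rule the_equality) (metis, metis PVar_diff_nonzero mult_right_cancel)

lemma divided_diff_times: "divided_diff i p * (PVar (Suc i) - PVar i) = p - swp i p"
  using divided_diff_exists[of i p] divided_diff_eqI by blast

lemma divided_diff_add: "divided_diff i (p + q) = divided_diff i p + divided_diff i q"
  by (rule divided_diff_eqI) (simp add: distrib_right divided_diff_times perm_vars_add)

lemma divided_diff_symmetric_mult:
  assumes "swp i p = p"
  shows "divided_diff i (p * q) = p * divided_diff i q"
proof (rule divided_diff_eqI)
  have "p * divided_diff i q * (PVar (Suc i) - PVar i) = p * (q - swp i q)"
    by (simp only: mult.assoc divided_diff_times)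
  also have "\<dots> = p * q - swp i (p * q)"
    using assms by (simp add: perm_vars_mult right_diff_distrib)
  finally show "p * divided_diff i q * (PVar (Suc i) - PVar i) = p * q - swp i (p * q)" .
qed

lemma divided_diff_symmetric: "swp i p = p \<Longrightarrow> divided_diff i p = 0"
  by (rule divided_diff_eqI) simp

lemma divided_diff_0 [simp]: "divided_diff i 0 = 0"
  by (rule divided_diff_symmetric) simp

lemma divided_diff_PConst_mult: "divided_diff i (PConst c * p) = PConst c * divided_diff i p"
  by (rule divided_diff_symmetric_mult) simp

text \<open>The twisted Leibniz rule for a variable; these are the relations between the \<open>\<psi>\<close> and the \<open>y\<close>.\<close>

lemma divided_diff_PVar_mult:
  "divided_diff i (PVar i * p) = PVar (Suc i) * divided_diff i p - p"
  "divided_diff i (PVar (Suc i) * p) = PVar i * divided_diff i p + p"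
  "k \<noteq> i \<Longrightarrow> k \<noteq> Suc i \<Longrightarrow> divided_diff i (PVar k * p) = PVar k * divided_diff i p"
proof -
  have "(PVar (Suc i) * divided_diff i p - p) * (PVar (Suc i) - PVar i) =
      PVar (Suc i) * (divided_diff i p * (PVar (Suc i) - PVar i)) - p * (PVar (Suc i) - PVar i)"
    by (simp add: algebra_simps)
  also have "\<dots> = PVar i * p - swp i (PVar i * p)"
    unfolding divided_diff_times by (simp add: perm_vars_mult algebra_simps)
  finally show "divided_diff i (PVar i * p) = PVar (Suc i) * divided_diff i p - p"
    by (rule divided_diff_eqI)
  have "(PVar i * divided_diff i p + p) * (PVar (Suc i) - PVar i) =
      PVar i * (divided_diff i p * (PVar (Suc i) - PVar i)) + p * (PVar (Suc i) - PVar i)"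
    by (simp add: algebra_simps)
  also have "\<dots> = PVar (Suc i) * p - swp i (PVar (Suc i) * p)"
    unfolding divided_diff_times by (simp add: perm_vars_mult algebra_simps)
  finally show "divided_diff i (PVar (Suc i) * p) = PVar i * divided_diff i p + p"
    by (rule divided_diff_eqI)
  show "divided_diff i (PVar k * p) = PVar k * divided_diff i p" if "k \<noteq> i" "k \<noteq> Suc i"
    using that by (intro divided_diff_symmetric_mult) simp
qed

lemma divided_diff_polys:
  assumes "i \<in> {1..<n}" "p \<in> polys {1..n}"
  shows "divided_diff i p \<in> polys {1..n}"
  using assms(2)
proof (induction p rule: polys_induct)
  case (const c)
  then show ?case by (simp add: divided_diff_symmetric)
next
  case (var k q)
  then show ?case
    using assms(1)
    by (cases "k = i"; cases "k = Suc i")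
      (auto simp: divided_diff_PVar_mult intro!: polys_mult polys_add polys_diff polys_PVar)
qed (simp add: divided_diff_add polys_add)

lemma swp_divided_diff: "swp i (divided_diff i p) = divided_diff i p"
proof -
  have "swp i (divided_diff i p) * (PVar (Suc i) - PVar i) =
      - swp i (divided_diff i p * (PVar (Suc i) - PVar i))"
    by (simp add: perm_vars_hom algebra_simps)
  also have "\<dots> = p - swp i p"
    unfolding divided_diff_times by (simp add: perm_vars_hom)
  finally show ?thesis
    by (metis divided_diff_eqI)
qed

lemma divided_diff_divided_diff: "divided_diff i (divided_diff i p) = 0"
  by (rule divided_diff_symmetric) (rule swp_divided_diff)

lemma perm_vars_divided_diff_times:
  assumes "bij w"
  shows "perm_vars w (divided_diff i p) * (PVar (w (Suc i)) - PVar (w i)) =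
    perm_vars w p - perm_vars (w \<circ> adj i) p"
  using arg_cong[OF divided_diff_times[of i p], of "perm_vars w"] assms
  by (simp add: perm_vars_hom perm_vars_comp)

text \<open>Both sides become the same signed sum of permuted polynomials after multiplication with the two
denominators.\<close>

lemma divided_diff_commute:
  assumes "Suc i < j"
  shows "divided_diff i (divided_diff j p) = divided_diff j (divided_diff i p)"
proof -
  let ?ui = "PVar (Suc i) - PVar i :: 'a mpoly" and ?uj = "PVar (Suc j) - PVar j :: 'a mpoly"
  have comm: "adj i \<circ> adj j = adj j \<circ> adj i"
    using assms by (auto simp: fun_eq_iff transpose_def)
  have 1: "divided_diff i (divided_diff j p) * ?ui * ?uj = p - swp j p - (swp i p - perm_vars (adj i \<circ> adj j) p)"
    using perm_vars_divided_diff_times[of "adj i" j p] assms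
    unfolding divided_diff_times left_diff_distrib[of _ _ ?uj] by simp
  have 2: "divided_diff j (divided_diff i p) * ?uj * ?ui = p - swp i p - (swp j p - perm_vars (adj j \<circ> adj i) p)"
    using perm_vars_divided_diff_times[of "adj j" i p] assms
    unfolding divided_diff_times left_diff_distrib[of _ _ ?ui] by simp
  have "divided_diff i (divided_diff j p) * (?ui * ?uj) = divided_diff j (divided_diff i p) * (?ui * ?uj)"
    using 1 2 by (simp add: comm mult_ac)
  then show ?thesis
    using PVar_diff_nonzero[where ?'a = 'a] by (metis mult_right_cancel no_zero_divisors)
qed

text \<open>After multiplication with the Vandermonde product of the three variables concerned, both sides
become the signed sum of \<open>p\<close> over the six permutations of these variables.\<close>

lemma divided_diff_braid:
  "divided_diff i (divided_diff (Suc i) (divided_diff i p)) =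
    divided_diff (Suc i) (divided_diff i (divided_diff (Suc i) p))"
proof -
  let ?s = "adj i" and ?t = "adj (Suc i)"
  define a b c where "a = (PVar i :: 'a mpoly)" and "b = (PVar (Suc i) :: 'a mpoly)"
    and "c = (PVar (Suc (Suc i)) :: 'a mpoly)"
  note defs = a_def b_def c_def
  let ?alt = "p - perm_vars ?s p - perm_vars ?t p + perm_vars (?s \<circ> ?t) p
    + perm_vars (?t \<circ> ?s) p - perm_vars (?s \<circ> ?t \<circ> ?s) p"
  have sts: "?t \<circ> ?s \<circ> ?t = ?s \<circ> ?t \<circ> ?s"
    by (auto simp: fun_eq_iff transpose_def)
  have bij: "bij ?s" "bij ?t" "bij (?s \<circ> ?t)" "bij (?t \<circ> ?s)"
    by (auto intro!: bij_comp)
  define g h k where "g = divided_diff i p" and "h = divided_diff (Suc i) g"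
    and "k = divided_diff i h"
  have g: "g * (b - a) = p - perm_vars ?s p"
    "perm_vars ?t g * (c - a) = perm_vars ?t p - perm_vars (?t \<circ> ?s) p"
    "perm_vars (?s \<circ> ?t) g * (c - b) = perm_vars (?s \<circ> ?t) p - perm_vars (?s \<circ> ?t \<circ> ?s) p"
    "perm_vars ?s g = g"
    using divided_diff_times[of i p] perm_vars_divided_diff_times[OF bij(2), of i p]
      perm_vars_divided_diff_times[OF bij(3), of i p] swp_divided_diff[of i p]
    by (simp_all add: defs g_def)
  have h: "h * (c - b) = g - perm_vars ?t g"
    "perm_vars ?s h * (c - a) = g - perm_vars (?s \<circ> ?t) g"
    using divided_diff_times[of "Suc i" g] perm_vars_divided_diff_times[OF bij(1), of "Suc i" g] g(4)
    by (simp_all add: defs h_def)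
  have k: "k * (b - a) = h - perm_vars ?s h"
    using divided_diff_times[of i h] by (simp add: defs k_def)
  have "k * ((b - a) * ((c - a) * (c - b))) =
      (c - a) * (h * (c - b)) - (c - b) * (perm_vars ?s h * (c - a))"
    using arg_cong[OF k, of "\<lambda>x. x * ((c - a) * (c - b))"] by (simp add: algebra_simps)
  also have "\<dots> = g * (b - a) - perm_vars ?t g * (c - a) + perm_vars (?s \<circ> ?t) g * (c - b)"
    unfolding h by (simp add: algebra_simps)
  also have "\<dots> = ?alt" unfolding g by simp
  finally have left: "k * ((b - a) * ((c - a) * (c - b))) = ?alt" .
  define g' h' k' where "g' = divided_diff (Suc i) p" and "h' = divided_diff i g'"
    and "k' = divided_diff (Suc i) h'"
  have g': "g' * (c - b) = p - perm_vars ?t p"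
    "perm_vars ?s g' * (c - a) = perm_vars ?s p - perm_vars (?s \<circ> ?t) p"
    "perm_vars (?t \<circ> ?s) g' * (b - a) = perm_vars (?t \<circ> ?s) p - perm_vars (?t \<circ> ?s \<circ> ?t) p"
    "perm_vars ?t g' = g'"
    using divided_diff_times[of "Suc i" p] perm_vars_divided_diff_times[OF bij(1), of "Suc i" p]
      perm_vars_divided_diff_times[OF bij(4), of "Suc i" p] swp_divided_diff[of "Suc i" p]
    by (simp_all add: defs g'_def)
  have h': "h' * (b - a) = g' - perm_vars ?s g'"
    "perm_vars ?t h' * (c - a) = g' - perm_vars (?t \<circ> ?s) g'"
    using divided_diff_times[of i g'] perm_vars_divided_diff_times[OF bij(2), of i g'] g'(4)
    by (simp_all add: defs h'_def)
  have k': "k' * (c - b) = h' - perm_vars ?t h'"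
    using divided_diff_times[of "Suc i" h'] by (simp add: defs k'_def)
  have "k' * ((b - a) * ((c - a) * (c - b))) =
      (c - a) * (h' * (b - a)) - (b - a) * (perm_vars ?t h' * (c - a))"
    using arg_cong[OF k', of "\<lambda>x. x * ((c - a) * (b - a))"] by (simp add: algebra_simps)
  also have "\<dots> = g' * (c - b) - perm_vars ?s g' * (c - a) + perm_vars (?t \<circ> ?s) g' * (b - a)"
    unfolding h' by (simp add: algebra_simps)
  also have "\<dots> = ?alt" unfolding g' sts by simp
  finally have "k * ((b - a) * ((c - a) * (c - b))) = k' * ((b - a) * ((c - a) * (c - b)))"
    using left by simp
  moreover have "(b - a) * ((c - a) * (c - b)) \<noteq> 0"
    by (simp add: defs)
  ultimately have "k = k'" by (metis mult_right_cancel)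
  then show ?thesis by (simp add: k_def h_def g_def k'_def h'_def g'_def)
qed

section \<open>Schur polynomials as iterated divided differences\<close>

definition xmonom :: "nat \<Rightarrow> (nat \<Rightarrow> nat) \<Rightarrow> 'a::field mpoly"
  where "xmonom n e = (\<Prod>k = 1..n. PVar k ^ e k)"

definition antisymmetrize :: "nat \<Rightarrow> 'a::field mpoly \<Rightarrow> 'a mpoly"
  where "antisymmetrize n p = (\<Sum>w | w permutes {1..n}. (- 1) ^ cox_length n w * perm_vars w p)"

abbreviation dd_word :: "nat list \<Rightarrow> 'a::field mpoly \<Rightarrow> 'a mpoly"
  where "dd_word \<equiv> foldr divided_diff"

lemma xmonom_cong: "(\<And>k. k \<in> {1..n} \<Longrightarrow> e k = e' k) \<Longrightarrow> xmonom n e = xmonom n e'"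
  unfolding xmonom_def by (rule prod.cong) auto

lemma alternant_eq_antisym: "alternant n e = antisymmetrize n (xmonom n e)"
  unfolding alternant_def antisymmetrize_def
  by (rule sum.cong) (auto simp: xmonom_def perm_vars_hom permutes_bij)

lemma perm_vars_xmonom:
  assumes w: "w permutes {1..n}"
  shows "(perm_vars w (xmonom n e) :: 'a::field mpoly) = xmonom n (e \<circ> pinv w)"
proof -
  have "(xmonom n (e \<circ> pinv w) :: 'a mpoly) = (\<Prod>k = 1..n. PVar (w k) ^ e (pinv w (w k)))"
    unfolding xmonom_def using prod.permute[OF w, of "\<lambda>k. PVar k ^ (e \<circ> pinv w) k :: 'a mpoly"] by simp
  also have "\<dots> = perm_vars w (xmonom n e)"
    using permutes_inverses(2)[OF w] permutes_bij[OF w]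
    by (simp add: xmonom_def perm_vars_hom)
  finally show ?thesis by simp
qed

lemma antisymmetrize_add: "antisymmetrize n (p + q) = antisymmetrize n p + antisymmetrize n q"
  unfolding antisymmetrize_def sum.distrib[symmetric]
  by (rule sum.cong) (auto simp: perm_vars_add permutes_bij distrib_left)

lemma minus_one_power_cox_length_adj:
  assumes w: "w permutes {1..n}" and i: "i \<in> {1..<n}"
  shows "((- 1) ^ cox_length n (w \<circ> adj i) :: 'b::ring_1) = - ((- 1) ^ cox_length n w)"
proof -
  have "permutation w" "permutation (adj i)"
    using w adj_permutes[OF i] by (auto simp: permutation_permutes)
  then have "sign (w \<circ> adj i) = - sign w"
    by (simp add: sign_compose sign_swap_id)
  then show ?thesis
    using w permutes_compose[OF adj_permutes[OF i] w]
    by (simp add: minus_one_power_cox_length)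
qed

lemma antisymmetrize_swp:
  assumes i: "i \<in> {1..<n}"
  shows "antisymmetrize n (swp i p) = - antisymmetrize n p"
proof -
  have "antisymmetrize n (swp i p) =
      (\<Sum>w | w permutes {1..n}. - ((- 1) ^ cox_length n (w \<circ> adj i) * perm_vars (w \<circ> adj i) p))"
    unfolding antisymmetrize_def
    by (rule sum.cong)
      (auto simp: perm_vars_comp permutes_bij minus_one_power_cox_length_adj[OF _ i]
        simp del: o_apply One_nat_def)
  also have "\<dots> = (\<Sum>w | w permutes {1..n}. - ((- 1) ^ cox_length n w * perm_vars w p))"
    by (rule sum.reindex_bij_witness[of _ "\<lambda>w. w \<circ> adj i" "\<lambda>w. w \<circ> adj i"])
      (auto simp: o_assoc[symmetric] intro!: permutes_compose[OF adj_permutes[OF i]]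
        simp del: o_apply One_nat_def)
  also have "\<dots> = - antisymmetrize n p"
    by (simp add: antisymmetrize_def sum_negf)
  finally show ?thesis .
qed

text \<open>The terms of \<open>w\<close> and \<open>w \<circ> adj i\<close> cancel. Deducing the claim from \<open>antisymmetrize_swp\<close> would only give
that twice the sum vanishes, which says nothing in characteristic two.\<close>

lemma antisymmetrize_symmetric_eq_0:
  assumes i: "i \<in> {1..<n}" and sym: "swp i p = p"
  shows "antisymmetrize n p = 0"
proof -
  let ?S = "{w. w permutes {1..n}}"
  let ?f = "\<lambda>w. (- 1) ^ cox_length n w * perm_vars w p"
  have fin: "finite ?S" by (rule finite_permutations) simp
  have f: "?f (w \<circ> adj i) = - ?f w" if "w permutes {1..n}" for w
    using that i perm_vars_comp[of w "adj i" p] sym permutes_bij[OF that]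
    by (simp add: minus_one_power_cox_length_adj del: o_apply)
  have neq: "w (Suc i) \<noteq> w i" if "w permutes {1..n}" for w
    using injD[OF permutes_inj[OF that], of "Suc i" i] by auto
  have "antisymmetrize n p = sum ?f {w \<in> ?S. w i < w (Suc i)} + sum ?f {w \<in> ?S. \<not> w i < w (Suc i)}"
    unfolding antisymmetrize_def
    by (subst sum.union_disjoint[symmetric]) (use fin in \<open>auto intro!: sum.cong\<close>)
  also have "sum ?f {w \<in> ?S. \<not> w i < w (Suc i)} = sum (\<lambda>w. - ?f w) {w \<in> ?S. w i < w (Suc i)}"
  proof (rule sum.reindex_bij_witness[of _ "\<lambda>w. w \<circ> adj i" "\<lambda>w. w \<circ> adj i"])
    fix w assume "w \<in> {w \<in> ?S. \<not> w i < w (Suc i)}"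
    then show "w \<circ> adj i \<in> {w \<in> ?S. w i < w (Suc i)}" "- ?f (w \<circ> adj i) = ?f w"
      using permutes_compose[OF adj_permutes[OF i], of w] neq[of w] f[of w] by auto
  qed (use permutes_compose[OF adj_permutes[OF i]] in \<open>auto simp: fun_eq_iff\<close>)
  finally show ?thesis by (simp add: sum_negf)
qed

text \<open>By the Leibniz rule \<open>x\<^bsub>i+1\<^esub> \<partial>\<^sub>i p = \<partial>\<^sub>i (x\<^sub>i p) + p\<close>, and \<open>q \<partial>\<^sub>i (x\<^sub>i p)\<close> is fixed by the transposition.\<close>

lemma antisymmetrize_divided_diff:
  assumes i: "i \<in> {1..<n}" and sym: "swp i q = q"
  shows "antisymmetrize n (q * PVar (Suc i) * divided_diff i p) = antisymmetrize n (q * p)"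
proof -
  have "q * PVar (Suc i) * divided_diff i p = q * divided_diff i (PVar i * p) + q * p"
    by (simp add: divided_diff_PVar_mult(1) right_diff_distrib mult.assoc)
  moreover have "antisymmetrize n (q * divided_diff i (PVar i * p)) = 0"
    by (rule antisymmetrize_symmetric_eq_0[OF i]) (simp add: perm_vars_mult sym swp_divided_diff)
  ultimately show ?thesis by (simp add: antisymmetrize_add)
qed

lemma antisymmetrize_mult_symmetric:
  assumes "\<And>w. w permutes {1..n} \<Longrightarrow> perm_vars w q = q"
  shows "antisymmetrize n (p * q) = antisymmetrize n p * q"
  unfolding antisymmetrize_def sum_distrib_right
  by (rule sum.cong) (auto simp: perm_vars_mult permutes_bij assms)

lemma bij_word_perm: "bij (word_perm is)"
proof (induction "is")
  case Nil
  then show ?case unfolding word_perm_simps by (rule bij_id)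
next
  case (Cons i "is")
  then show ?case
    unfolding word_perm_simps by (intro bij_comp bij_transpose)
qed

lemma perm_vars_word_perm_Cons:
  "perm_vars (word_perm (i # is)) p = swp i (perm_vars (word_perm is) p)"
  unfolding word_perm_simps by (rule perm_vars_comp[OF bij_transpose bij_word_perm, symmetric])

lemma antisymmetrize_perm_vars_word:
  "set is \<subseteq> {1..<n} \<Longrightarrow> antisymmetrize n (perm_vars (word_perm is) p) = (- 1) ^ length is * antisymmetrize n p"
proof (induction "is")
  case (Cons i "is")
  then show ?case
    by (simp add: perm_vars_word_perm_Cons antisymmetrize_swp del: word_perm_simps)
qed simp

text \<open>Peels off the letters of one block from the left. The exponents \<open>j - k\<close> at the start of the block
are lowered by one for the variables already treated, so that when the letter \<open>i\<close> is
reached the variables \<open>i\<close> and \<open>i + 1\<close> have exponents \<open>i - k\<close> and \<open>i + 1 - k\<close>, exactly as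
\<open>antisymmetrize_divided_diff\<close> requires.\<close>

lemma antisymmetrize_staircase_block:
  fixes p :: "'a::field mpoly"
  assumes "1 \<le> k" "k \<le> i" "i \<le> n"
  shows "antisymmetrize n (xmonom n (\<lambda>j. if j \<le> i then j - k else j - Suc k) * dd_word (rev [k..<i]) p) =
    antisymmetrize n (xmonom n (\<lambda>j. j - Suc k) * p)"
  using assms(2,3)
proof (induction i rule: dec_induct)
  case base
  have "(xmonom n (\<lambda>j. if j \<le> k then j - k else j - Suc k) :: 'a mpoly) = xmonom n (\<lambda>j. j - Suc k)"
    by (rule xmonom_cong) auto
  then show ?case by simp
next
  case (step i)
  let ?e = "\<lambda>i j. if j \<le> i then j - k else j - Suc k"
  have i: "i \<in> {1..<n}" using step assms by auto
  have "(swp i (xmonom n (?e i)) :: 'a mpoly) = xmonom n (?e i \<circ> pinv (adj i))"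
    by (rule perm_vars_xmonom[OF adj_permutes[OF i]])
  also have "\<dots> = xmonom n (?e i)"
    by (rule xmonom_cong) (auto simp: transpose_def)
  finally have sym: "(swp i (xmonom n (?e i)) :: 'a mpoly) = xmonom n (?e i)" .
  have "(xmonom n (?e (Suc i)) :: 'a mpoly) = (\<Prod>j = 1..n. PVar j ^ ?e i j * (if j = Suc i then PVar j else 1))"
    unfolding xmonom_def using step.hyps
    by (intro prod.cong) (auto simp: Suc_diff_le le_Suc_eq simp flip: power_Suc2)
  also have "\<dots> = xmonom n (?e i) * PVar (Suc i)"
    using i by (simp add: xmonom_def prod.distrib del: One_nat_def)
  finally show ?case
    using antisymmetrize_divided_diff[OF i sym, of "dd_word (rev [k..<i]) p"] step by simp
qed

lemma antisymmetrize_staircase_word: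
  fixes p :: "'a::field mpoly"
  assumes "1 \<le> k" "k \<le> n"
  shows "antisymmetrize n (xmonom n (\<lambda>j. j - k) * dd_word (staircase_word n k) p) = antisymmetrize n p"
  using assms(2,1)
proof (induction k rule: inc_induct)
  case base
  have "(xmonom n (\<lambda>j. j - n) :: 'a mpoly) = xmonom n (\<lambda>j. 0)"
    by (rule xmonom_cong) auto
  then show ?case by (simp add: staircase_word_def xmonom_def)
next
  case (step k)
  have "(xmonom n (\<lambda>j. j - k) :: 'a mpoly) = xmonom n (\<lambda>j. if j \<le> n then j - k else j - Suc k)"
    by (rule xmonom_cong) auto
  then show ?case
    using antisymmetrize_staircase_block[of k n n "dd_word (staircase_word n (Suc k)) p"] step
    by (simp add: staircase_word_rec)
qed

lemma dd_word_reduced_eq: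
  assumes "reduced_expr n w is" "reduced_expr n w js"
  shows "dd_word is p = dd_word js p"
  by (rule matsumoto[OF _ _ assms]) (rule divided_diff_commute divided_diff_braid, simp?)+

lemma swp_dd_word_longest:
  assumes "reduced_expr n (longest_perm n) is" and i: "i \<in> {1..<n}"
  shows "swp i (dd_word is p) = dd_word is p"
proof -
  obtain js where "reduced_expr n (longest_perm n) (i # js)"
    using exists_reduced_expr_longest_Cons[OF i] by blast
  then have "dd_word is p = divided_diff i (dd_word js p)"
    using dd_word_reduced_eq[OF assms(1), of "i # js" p] by simp
  then show ?thesis by (simp add: swp_divided_diff)
qed

text \<open>A polynomial fixed by all adjacent transpositions is symmetric, and \<open>divided_diff i\<close> has values fixed
by the \<open>i\<close>-th one.\<close>

lemma perm_vars_dd_word_longest: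
  assumes red: "reduced_expr n (longest_perm n) is" and w: "w permutes {1..n}"
  shows "perm_vars w (dd_word is p) = dd_word is p"
proof -
  have "set js \<subseteq> {1..<n} \<Longrightarrow> perm_vars (word_perm js) (dd_word is p) = dd_word is p" for js
  proof (induction js)
    case (Cons j js)
    then show ?case
      by (simp add: perm_vars_word_perm_Cons swp_dd_word_longest[OF red] del: word_perm_simps)
  qed simp
  then show ?thesis
    using exists_reduced_expr[OF w] by (auto simp: reduced_expr_def)
qed

text \<open>The monomial on the left is the reversal of $x^\delta$; the sign is that of the longest permutation.\<close>

lemma antisymmetrize_reversed_staircase:
  "(antisymmetrize n (xmonom n (\<lambda>j. j - 1)) :: 'a::field mpoly) = (- 1) ^ (n * (n - 1) div 2) * alternant n (\<lambda>k. n - k)"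
proof -
  obtain "is" where red: "reduced_expr n (longest_perm n) is"
    using exists_reduced_expr[OF reversal_permutes] unfolding longest_perm_eq_reversal by blast
  have "(perm_vars (reversal n) (xmonom n (\<lambda>k. n - k)) :: 'a mpoly) = xmonom n ((\<lambda>k. n - k) \<circ> reversal n)"
    using perm_vars_xmonom[OF reversal_permutes] by simp
  also have "\<dots> = xmonom n (\<lambda>j. j - 1)"
    by (rule xmonom_cong) (auto simp: reversal_def)
  finally show ?thesis
    using antisymmetrize_perm_vars_word[of "is" n "xmonom n (\<lambda>k. n - k) :: 'a mpoly"] red length_reduced_expr_longest[OF red]
    by (simp add: reduced_expr_def longest_perm_eq_reversal alternant_eq_antisym del: One_nat_def)
qed

text \<open>The symmetric factor is pulled out of the antisymmetrization of
$x_2 x_3^2 \cdots x_n^{n-1}\,T(x^e)$.\<close>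

lemma alternant_eq_dd_word:
  assumes n: "n \<ge> 1" and red: "reduced_expr n (longest_perm n) is"
  shows "(- 1) ^ (n * (n - 1) div 2) * dd_word is (xmonom n e) * alternant n (\<lambda>k. n - k) =
    (alternant n e :: 'a::field mpoly)"
proof -
  let ?T = "dd_word is (xmonom n e) :: 'a mpoly"
  have "alternant n e = antisymmetrize n (xmonom n (\<lambda>j. j - 1) * ?T)"
    using antisymmetrize_staircase_word[of 1 n "xmonom n e :: 'a mpoly"] n
      dd_word_reduced_eq[OF red reduced_staircase_word[OF n], of "xmonom n e :: 'a mpoly"]
    by (simp add: alternant_eq_antisym del: One_nat_def)
  also have "\<dots> = antisymmetrize n (xmonom n (\<lambda>j. j - 1)) * ?T"
    by (rule antisymmetrize_mult_symmetric) (rule perm_vars_dd_word_longest[OF red])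
  finally show ?thesis
    by (simp add: antisymmetrize_reversed_staircase mult_ac del: One_nat_def)
qed

text \<open>The exponent vector of \<open>xmonom n e\<close>; it ignores the values of \<open>e\<close> outside \<open>{1..n}\<close>.\<close>

definition expvec :: "nat \<Rightarrow> (nat \<Rightarrow> nat) \<Rightarrow> nat \<Rightarrow>\<^sub>0 nat"
  where "expvec n e = (\<Sum>k = 1..n. Poly_Mapping.single k (e k))"

lemma lookup_expvec: "Poly_Mapping.lookup (expvec n e) k = (if k \<in> {1..n} then e k else 0)"
  by (simp add: expvec_def lookup_sum lookup_single when_def)

lemma PVar_power: "PVar k ^ e = Poly_Mapping.single (Poly_Mapping.single k e) 1"
  by (induction e) (simp_all add: PVar_def mult_single flip: single_add)

lemma prod_single_one:
  "(\<Prod>k\<in>A. Poly_Mapping.single (f k) 1) = Poly_Mapping.single (\<Sum>k\<in>A. f k) (1 :: 'b::comm_semiring_1)"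
  by (induction A rule: infinite_finite_induct) (simp_all add: mult_single)

lemma xmonom_eq_single: "xmonom n e = Poly_Mapping.single (expvec n e) 1"
  by (simp add: xmonom_def PVar_power prod_single_one expvec_def)

lemma minus_one_power_eq_PConst: "(- 1) ^ k = PConst ((- 1) ^ k)"
  by (induction k) (simp_all add: PConst_uminus)

text \<open>The exponents $n-1, \dots, 1, 0$ are distinct, so only the identity permutation contributes to the
coefficient of $x^\delta$, which is therefore one.\<close>

lemma alternant_staircase_nonzero: "alternant n (\<lambda>k. n - k) \<noteq> (0 :: 'a::field mpoly)"
proof -
  let ?e = "\<lambda>k. n - k"
  have eq: "w = id" if w: "w permutes {1..n}" and "expvec n (?e \<circ> pinv w) = expvec n ?e" for w
  proof -
    have "pinv w k = k" for k
    proof (cases "k \<in> {1..n}")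
      case True
      then have "n - pinv w k = n - k"
        using arg_cong[OF that(2), of "\<lambda>m. Poly_Mapping.lookup m k"]
        by (simp add: lookup_expvec)
      moreover have "pinv w k \<in> {1..n}"
        using True permutes_in_image[OF permutes_inv[OF w]] by blast
      ultimately show ?thesis using True by auto
    next
      case False
      then show ?thesis using permutes_not_in[OF permutes_inv[OF w]] by blast
    qed
    then have "pinv w = id" by auto
    then show ?thesis using pinv_pinv[OF w] by (metis inv_id)
  qed
  have "Poly_Mapping.lookup (alternant n ?e :: 'a mpoly) (expvec n ?e) =
      (\<Sum>w | w permutes {1..n}. if w = id then 1 else 0)"
    unfolding alternant_eq_antisym antisymmetrize_def lookup_sum
  proof (rule sum.cong)
    fix w assume "w \<in> {w. w permutes {1..n}}"
    then have w: "w permutes {1..n}" by simp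
    have "cox_length n id = 0"
      by (simp add: cox_length_eq_card_inversions permutes_id del: id_apply)
    then show "Poly_Mapping.lookup ((- 1) ^ cox_length n w * perm_vars w (xmonom n ?e :: 'a mpoly))
        (expvec n ?e) = (if w = id then 1 else 0)"
      using eq[OF w] unfolding perm_vars_xmonom[OF w]
      by (auto simp: inv_id xmonom_eq_single minus_one_power_eq_PConst
          PConst_mult_single lookup_single when_def simp del: id_apply)
  qed simp
  also have "\<dots> = 1"
    using finite_permutations[of "{1..n}"] by (simp add: permutes_id del: id_apply)
  finally show ?thesis by auto
qed

lemma schur_eq_dd_word:
  assumes n: "n \<ge> 1" and red: "reduced_expr n (longest_perm n) is"
  shows "(schur n l :: 'a::field mpoly) =
    (- 1) ^ (n * (n - 1) div 2) * dd_word is (xmonom n (\<lambda>k. l k + (n - k)))"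
  unfolding schur_def exact_quot_def
proof (rule the_equality)
  note * = alternant_eq_dd_word[OF n red, of "\<lambda>k. l k + (n - k)"]
  show "(- 1) ^ (n * (n - 1) div 2) * dd_word is (xmonom n (\<lambda>k. l k + (n - k))) *
      alternant n (\<lambda>k. n - k) = alternant n (\<lambda>k. l k + (n - k))"
    by (rule *)
  fix r :: "'a mpoly" assume r: "r * alternant n (\<lambda>k. n - k) = alternant n (\<lambda>k. l k + (n - k))"
  have "r * alternant n (\<lambda>k. n - k) = (- 1) ^ (n * (n - 1) div 2) *
      dd_word is (xmonom n (\<lambda>k. l k + (n - k))) * alternant n (\<lambda>k. n - k)"
    unfolding r by (rule *[symmetric])
  then show "r = (- 1) ^ (n * (n - 1) div 2) * dd_word is (xmonom n (\<lambda>k. l k + (n - k)))"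
    by (rule mult_right_cancel[OF alternant_staircase_nonzero[of n], THEN iffD1])
qed

section \<open>The nilHecke algebra as a quotient\<close>

abbreviation fcar :: "nat \<Rightarrow> 'a::field nh_free set"
  where "fcar n \<equiv> carrier (free_alg n)"

definition fgen :: "nh_gen \<Rightarrow> 'a::field nh_free"
  where "fgen g = Poly_Mapping.single (Word [g]) 1"

lemma fpsi_eq_fgen: "fpsi r = fgen (GPsi r)" and fy_eq_fgen: "fy k = fgen (GY k)"
  by (simp_all add: fpsi_def fy_def fgen_def)

lemma free_alg_simps [simp]:
  "mult (free_alg n) = (*)" "one (free_alg n) = 1" "zero (free_alg n) = 0" "add (free_alg n) = (+)"
  by (simp_all add: free_alg_def)

lemma fcar_iff: "a \<in> fcar n \<longleftrightarrow> (\<forall>w\<in>Poly_Mapping.keys a. set (letters w) \<subseteq> nh_gens n)"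
  by (simp add: free_alg_def)

lemma fcar_single: "set (letters w) \<subseteq> nh_gens n \<Longrightarrow> Poly_Mapping.single w c \<in> fcar n"
  by (simp add: fcar_iff)

lemma letters_0 [simp]: "letters 0 = []"
  by (simp add: zero_nh_word_def)

lemma letters_add [simp]: "letters (u + v) = letters u @ letters v"
  by (simp add: plus_nh_word_def)

lemma fcar_fconst [simp]: "fconst c \<in> fcar n"
  by (simp add: fconst_def fcar_single)

lemma fconst_0 [simp]: "fconst 0 = 0" and fconst_1 [simp]: "fconst 1 = 1"
  by (simp_all add: fconst_def)

lemma fconst_uminus: "fconst (- c) = - fconst c"
  by (simp add: fconst_def single_uminus)

lemma fconst_mult: "fconst (c * d) = fconst c * fconst d"
  by (simp add: fconst_def mult_single)

lemma fconst_add: "fconst (c + d) = fconst c + fconst d"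
  by (simp add: fconst_def single_add)

lemma fcar_0 [simp]: "0 \<in> fcar n" and fcar_1 [simp]: "1 \<in> fcar n"
  using fcar_fconst[of 0 n] fcar_fconst[of 1 n] by simp_all

lemma fcar_add: "a \<in> fcar n \<Longrightarrow> b \<in> fcar n \<Longrightarrow> a + b \<in> fcar n"
  using keys_add[of a b] unfolding fcar_iff by blast

lemma fcar_mult:
  assumes "a \<in> fcar n" "b \<in> fcar n"
  shows "a * b \<in> fcar n"
  unfolding fcar_iff
proof
  fix w assume "w \<in> Poly_Mapping.keys (a * b)"
  then obtain u v where "u \<in> Poly_Mapping.keys a" "v \<in> Poly_Mapping.keys b" "w = u + v"
    using keys_mult[of a b] by blast
  then show "set (letters w) \<subseteq> nh_gens n"
    using assms unfolding fcar_iff by auto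
qed

lemma fcar_uminus: "a \<in> fcar n \<Longrightarrow> - a \<in> fcar n"
  using fcar_mult[OF fcar_fconst[of "- 1" n]] by (simp add: fconst_uminus)

lemma fcar_diff: "a \<in> fcar n \<Longrightarrow> b \<in> fcar n \<Longrightarrow> a - b \<in> fcar n"
  using fcar_add[of a n "- b"] by (simp add: fcar_uminus)

lemma fcar_power: "a \<in> fcar n \<Longrightarrow> a ^ k \<in> fcar n"
  by (induction k) (simp_all add: fcar_mult)

lemma fcar_prod_list: "(\<And>a. a \<in> set as \<Longrightarrow> a \<in> fcar n) \<Longrightarrow> prod_list as \<in> fcar n"
  by (induction as) (simp_all add: fcar_mult)

lemma fcar_sum: "(\<And>i. i \<in> A \<Longrightarrow> f i \<in> fcar n) \<Longrightarrow> sum f A \<in> fcar n"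
  by (induction A rule: infinite_finite_induct) (simp_all add: fcar_add)

lemma fcar_fgen: "g \<in> nh_gens n \<Longrightarrow> fgen g \<in> fcar n"
  by (simp add: fgen_def fcar_single)

lemma fcar_fpsi: "r \<in> {1..<n} \<Longrightarrow> fpsi r \<in> fcar n"
  by (simp add: fpsi_eq_fgen fcar_fgen nh_gens_def)

lemma fcar_fy: "k \<in> {1..n} \<Longrightarrow> fy k \<in> fcar n"
  by (simp add: fy_eq_fgen fcar_fgen nh_gens_def)

lemmas fcar_intros = fcar_add fcar_mult fcar_uminus fcar_diff fcar_power fcar_prod_list fcar_sum
  fcar_fpsi fcar_fy fcar_fconst fcar_0 fcar_1

text \<open>The free algebra is spanned by words, which are built by prefixing one generator at a time.\<close>

lemma fcar_induct [consumes 1, case_names const gen add]: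
  assumes a: "a \<in> fcar n"
    and const: "\<And>c. P (fconst c)"
    and gen: "\<And>g a. g \<in> nh_gens n \<Longrightarrow> a \<in> fcar n \<Longrightarrow> P a \<Longrightarrow> P (fgen g * a)"
    and add: "\<And>a b. a \<in> fcar n \<Longrightarrow> b \<in> fcar n \<Longrightarrow> P a \<Longrightarrow> P b \<Longrightarrow> P (a + b)"
  shows "P a"
proof -
  have word: "P (Poly_Mapping.single (Word xs) c)" if "set xs \<subseteq> nh_gens n" for xs c
    using that
  proof (induction xs)
    case Nil
    then show ?case using const[of c] by (simp add: fconst_def zero_nh_word_def)
  next
    case (Cons g xs)
    then have "P (fgen g * Poly_Mapping.single (Word xs) c)"
      by (intro gen fcar_single) auto
    then show ?case by (simp add: fgen_def mult_single plus_nh_word_def)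
  qed
  have "a \<in> fcar n \<and> P a"
  proof (rule poly_mapping_single_induct[of "\<lambda>a. a \<in> fcar n \<and> P a" a])
    show "0 \<in> fcar n \<and> P 0" using const[of 0] by simp
    fix w c assume "w \<in> Poly_Mapping.keys a"
    then show "Poly_Mapping.single w c \<in> fcar n \<and> P (Poly_Mapping.single w c)"
      using word[of "letters w" c] a by (simp add: fcar_single) (simp add: fcar_iff)
  qed (auto intro: fcar_add add)
  then show ?thesis ..
qed

lemma fconst_central: "fconst c * a = a * fconst c"
  by (rule poly_mapping_single_induct[of "\<lambda>a. fconst c * a = a * fconst c"])
    (simp_all add: fconst_def mult_single mult.commute distrib_left distrib_right)

lemma minus_one_power_eq_fconst: "(- 1) ^ k = fconst ((- 1) ^ k)"
  by (induction k) (simp_all add: fconst_uminus)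

lemma ring_free_alg: "ring (free_alg n)"
proof (rule ringI)
  show "abelian_group (free_alg n)"
    by (rule abelian_groupI) (auto simp: add.assoc add.commute fcar_add intro: bexI[of _ "- _"] fcar_uminus)
  show "monoid (free_alg n)"
    by (rule monoidI) (auto simp: mult.assoc fcar_mult)
qed (auto simp: distrib_left distrib_right)

lemma a_inv_free_alg: "a \<in> fcar n \<Longrightarrow> \<ominus>\<^bsub>free_alg n\<^esub> a = - a"
proof -
  assume a: "a \<in> fcar n"
  interpret ring "free_alg n" by (rule ring_free_alg)
  show ?thesis
    by (rule minus_equality) (use a in \<open>simp_all add: fcar_uminus\<close>)
qed

text \<open>Closure under negation comes for free, as multiplication with the scalar \<open>-1\<close> takes place inside the
algebra.\<close>

lemma ideal_free_algI:
  assumes "I \<subseteq> fcar n" "0 \<in> I" "\<And>a b. a \<in> I \<Longrightarrow> b \<in> I \<Longrightarrow> a + b \<in> I"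
    and "\<And>a x. a \<in> I \<Longrightarrow> x \<in> fcar n \<Longrightarrow> x * a \<in> I" "\<And>a x. a \<in> I \<Longrightarrow> x \<in> fcar n \<Longrightarrow> a * x \<in> I"
  shows "ideal I (free_alg n)"
proof (rule idealI[OF ring_free_alg])
  interpret ring "free_alg n" by (rule ring_free_alg)
  have inv: "m_inv (add_monoid (free_alg n)) a \<in> I" if a: "a \<in> I" for a
  proof -
    have "- a \<in> I"
      using assms(4)[OF a fcar_fconst[of "- 1"]] by (simp add: fconst_uminus)
    then show ?thesis
      using a_inv_free_alg[of a n] a assms(1) unfolding a_inv_def by auto
  qed
  show "subgroup I (add_monoid (free_alg n))"
    by (rule group.subgroupI[OF a_group]) (use assms(1-3) inv in auto)
qed (use assms in auto)

lemma nh_rels_subset: "nh_rels n \<subseteq> fcar n"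
  unfolding nh_rels_def by (auto intro!: fcar_intros)

lemma ideal_nh_ideal: "ideal (nh_ideal n) (free_alg n)"
  unfolding nh_ideal_def by (rule ring.genideal_ideal[OF ring_free_alg nh_rels_subset])

lemma nh_ideal_rels: "a \<in> nh_rels n \<Longrightarrow> a \<in> nh_ideal n"
  unfolding nh_ideal_def using ring.genideal_self[OF ring_free_alg nh_rels_subset] by blast

lemma nh_ideal_minimal: "ideal I (free_alg n) \<Longrightarrow> nh_rels n \<subseteq> I \<Longrightarrow> nh_ideal n \<subseteq> I"
  unfolding nh_ideal_def by (rule ring.genideal_minimal[OF ring_free_alg])

lemma nh_ideal_0: "0 \<in> nh_ideal n"
  using additive_subgroup.zero_closed[OF ideal.axioms(1)[OF ideal_nh_ideal]] by simp

lemma nh_ideal_add: "a \<in> nh_ideal n \<Longrightarrow> b \<in> nh_ideal n \<Longrightarrow> a + b \<in> nh_ideal n"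
  using additive_subgroup.a_closed[OF ideal.axioms(1)[OF ideal_nh_ideal]] by fastforce

lemma nh_ideal_mult_left: "a \<in> nh_ideal n \<Longrightarrow> x \<in> fcar n \<Longrightarrow> x * a \<in> nh_ideal n"
  using ideal.I_l_closed[OF ideal_nh_ideal] by fastforce

lemma nh_ideal_mult_right: "a \<in> nh_ideal n \<Longrightarrow> x \<in> fcar n \<Longrightarrow> a * x \<in> nh_ideal n"
  using ideal.I_r_closed[OF ideal_nh_ideal] by fastforce

lemma nh_ideal_uminus: "a \<in> nh_ideal n \<Longrightarrow> - a \<in> nh_ideal n"
  using nh_ideal_mult_left[OF _ fcar_fconst[of "- 1"]] by (simp add: fconst_uminus)

lemma nh_class_eq: "nh_class n a = (\<lambda>u. u + a) ` nh_ideal n"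
  unfolding nh_class_def a_r_coset_def r_coset_def by auto

lemma nh_class_eq_iff: "nh_class n a = nh_class n b \<longleftrightarrow> a - b \<in> nh_ideal n"
proof
  assume "nh_class n a = nh_class n b"
  moreover have "a \<in> nh_class n a"
    unfolding nh_class_eq using nh_ideal_0[of n] by force
  ultimately show "a - b \<in> nh_ideal n"
    unfolding nh_class_eq by auto
next
  have sub: "nh_class n a \<subseteq> nh_class n b" if ab: "a - b \<in> nh_ideal n" for a b :: "'a nh_free"
  proof
    fix x assume "x \<in> nh_class n a"
    then obtain u where u: "u \<in> nh_ideal n" "x = u + a" unfolding nh_class_eq by blast
    then show "x \<in> nh_class n b"
      unfolding nh_class_eq
      using nh_ideal_add[OF u(1) ab] by (intro image_eqI[of _ _ "u + (a - b)"]) simp_all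
  qed
  assume "a - b \<in> nh_ideal n"
  then show "nh_class n a = nh_class n b"
    using sub[of a b] sub[of b a] nh_ideal_uminus[of "a - b" n] by auto
qed

lemma ring_nilHecke: "ring (nilHecke n)"
  unfolding nilHecke_def by (rule ideal.quotient_is_ring[OF ideal_nh_ideal])

lemma nh_class_ring_hom: "nh_class n \<in> ring_hom (free_alg n) (nilHecke n)"
  using ideal.rcos_ring_hom[OF ideal_nh_ideal] unfolding nilHecke_def nh_class_def[abs_def] .

lemma nh_class_closed: "a \<in> fcar n \<Longrightarrow> nh_class n a \<in> carrier (nilHecke n)"
  by (rule ring_hom_closed[OF nh_class_ring_hom])

lemma nh_class_mult:
  "a \<in> fcar n \<Longrightarrow> b \<in> fcar n \<Longrightarrow> nh_class n (a * b) = nh_class n a \<otimes>\<^bsub>nilHecke n\<^esub> nh_class n b"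
  using ring_hom_mult[OF nh_class_ring_hom] by simp

lemma nh_class_add:
  "a \<in> fcar n \<Longrightarrow> b \<in> fcar n \<Longrightarrow> nh_class n (a + b) = nh_class n a \<oplus>\<^bsub>nilHecke n\<^esub> nh_class n b"
  using ring_hom_add[OF nh_class_ring_hom] by simp

lemma nh_class_1: "nh_class n 1 = \<one>\<^bsub>nilHecke n\<^esub>"
  using ring_hom_one[OF nh_class_ring_hom] by simp

lemma nh_class_0: "nh_class n 0 = \<zero>\<^bsub>nilHecke n\<^esub>"
  unfolding nilHecke_def FactRing_def nh_class_eq by simp

lemma nh_class_uminus:
  assumes "a \<in> fcar n"
  shows "nh_class n (- a) = \<ominus>\<^bsub>nilHecke n\<^esub> nh_class n a"
proof -
  interpret ring "nilHecke n" by (rule ring_nilHecke)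
  have "nh_class n (- a) \<oplus>\<^bsub>nilHecke n\<^esub> nh_class n a = \<zero>\<^bsub>nilHecke n\<^esub>"
    using nh_class_add[of "- a" n a] assms by (simp add: fcar_uminus nh_class_0)
  then show ?thesis
    using assms by (intro minus_equality[symmetric]) (auto simp: nh_class_closed fcar_uminus)
qed

lemma nh_class_diff:
  "a \<in> fcar n \<Longrightarrow> b \<in> fcar n \<Longrightarrow> nh_class n (a - b) = nh_class n a \<ominus>\<^bsub>nilHecke n\<^esub> nh_class n b"
  using nh_class_add[of a n "- b"] by (simp add: fcar_uminus nh_class_uminus a_minus_def)

lemma nh_class_power:
  "a \<in> fcar n \<Longrightarrow> nh_class n (a ^ k) = nh_class n a [^]\<^bsub>nilHecke n\<^esub> k"
proof (induction k)
  case 0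
  interpret ring "nilHecke n" by (rule ring_nilHecke)
  show ?case by (simp add: nh_class_1)
next
  case (Suc k)
  interpret ring "nilHecke n" by (rule ring_nilHecke)
  show ?case
    using Suc nh_class_mult[of "a ^ k" n a] by (simp add: fcar_power power_Suc2 del: power_Suc)
qed

lemma nh_class_prod_list:
  "(\<And>a. a \<in> set as \<Longrightarrow> a \<in> fcar n) \<Longrightarrow>
    nh_class n (prod_list as) = nh_prod_list n (map (nh_class n) as)"
  by (induction as) (simp_all add: nh_prod_list_def nh_class_1 nh_class_mult fcar_prod_list)

text \<open>Connects \<open>finsum\<close> in the quotient with the ordinary sum of representatives.\<close>

lemma nh_class_sum:
  assumes "finite A" "\<And>i. i \<in> A \<Longrightarrow> f i \<in> fcar n"
  shows "nh_class n (sum f A) = (\<Oplus>\<^bsub>nilHecke n\<^esub>i\<in>A. nh_class n (f i))"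
  using assms
proof (induction A rule: finite_induct)
  interpret ring "nilHecke n" by (rule ring_nilHecke)
  {
    case empty
    then show ?case by (simp add: nh_class_0)
  next
    case (insert i A)
    then show ?case
      by (subst finsum_insert) (auto simp: nh_class_add fcar_sum nh_class_closed)
  }
qed

lemma nilHecke_carrier: "h \<in> carrier (nilHecke n) \<Longrightarrow> \<exists>a\<in>fcar n. h = nh_class n a"
  unfolding nilHecke_def FactRing_def A_RCOSETS_def' nh_class_def by auto

section \<open>The polynomial representation\<close>

lemma gen_act_add: "gen_act g (p + q) = gen_act g p + gen_act g q"
  by (cases g) (simp_all add: divided_diff_add distrib_left)

lemma gen_act_PConst_mult: "gen_act g (PConst c * p) = PConst c * gen_act g p"
  by (cases g) (simp_all add: divided_diff_PConst_mult mult.left_commute)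

lemma word_act_add: "foldr gen_act xs (p + q) = foldr gen_act xs p + foldr gen_act xs q"
  by (induction xs) (simp_all add: gen_act_add)

lemma word_act_PConst_mult: "foldr gen_act xs (PConst c * p) = PConst c * foldr gen_act xs p"
  by (induction xs) (simp_all add: gen_act_PConst_mult)

lemma PConst_add: "PConst (c + d) = PConst c + PConst d"
  by (simp add: PConst_def single_add)

lemma free_act_single:
  "free_act (Poly_Mapping.single w c) p = PConst c * foldr gen_act (letters w) p"
  by (simp add: free_act_def)

lemma free_act_0 [simp]: "free_act 0 p = 0"
  by (simp add: free_act_def)

lemma free_act_add: "free_act (a + b) p = free_act a p + free_act b p"
  unfolding free_act_def
  by (rule setsum_keys_plus_distrib) (simp_all add: PConst_add distrib_right)

lemma free_act_add_right: "free_act a (p + q) = free_act a p + free_act a q"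
  by (simp add: free_act_def word_act_add distrib_left sum.distrib)

lemma free_act_PConst_mult: "free_act a (PConst c * p) = PConst c * free_act a p"
  by (simp add: free_act_def word_act_PConst_mult sum_distrib_left mult.left_commute)

lemma free_act_mult: "free_act (a * b) p = free_act a (free_act b p)"
proof -
  have single: "free_act (Poly_Mapping.single w c * b) p =
      free_act (Poly_Mapping.single w c) (free_act b p)" for w c
  proof (rule poly_mapping_single_induct[of "\<lambda>b. free_act (Poly_Mapping.single w c * b) p =
      free_act (Poly_Mapping.single w c) (free_act b p)"])
    show "free_act (Poly_Mapping.single w c * 0) p = free_act (Poly_Mapping.single w c) (free_act 0 p)"
      using free_act_PConst_mult[of _ 0 0] by simp
    show "free_act (Poly_Mapping.single w c * Poly_Mapping.single v d) p =
        free_act (Poly_Mapping.single w c) (free_act (Poly_Mapping.single v d) p)" for v d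
      by (simp add: mult_single free_act_single word_act_PConst_mult mult.assoc flip: PConst_mult)
  qed (simp add: distrib_left free_act_add free_act_add_right)
  show ?thesis
    by (rule poly_mapping_single_induct[of "\<lambda>a. free_act (a * b) p = free_act a (free_act b p)"])
      (simp_all add: single distrib_right free_act_add)
qed

lemma free_act_fconst [simp]: "free_act (fconst c) p = PConst c * p"
  by (simp add: fconst_def free_act_single)

lemma free_act_1 [simp]: "free_act 1 p = p"
  using free_act_fconst[of 1 p] by simp

lemma free_act_fgen [simp]: "free_act (fgen g) p = gen_act g p"
  by (simp add: fgen_def free_act_single)

lemma free_act_fpsi [simp]: "free_act (fpsi r) p = divided_diff r p"
  and free_act_fy [simp]: "free_act (fy k) p = PVar k * p"
  by (simp_all add: fpsi_eq_fgen fy_eq_fgen)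

lemma free_act_uminus: "free_act (- a) p = - free_act a p"
  using free_act_mult[of "fconst (- 1)" a p]
  unfolding free_act_fconst by (simp add: fconst_uminus PConst_uminus)

lemma free_act_diff: "free_act (a - b) p = free_act a p - free_act b p"
  using free_act_add[of a "- b" p] by (simp add: free_act_uminus)

lemma free_act_sum: "free_act (sum f A) p = (\<Sum>i\<in>A. free_act (f i) p)"
  by (induction A rule: infinite_finite_induct) (simp_all add: free_act_add)

text \<open>The elements of the free algebra that act as zero form an ideal, which contains the defining relations
by the properties of divided differences. Hence the action is well defined on the quotient.\<close>

lemma free_act_nh_ideal:
  assumes "a \<in> nh_ideal n"
  shows "free_act a p = 0"
proof -
  let ?I = "{a \<in> fcar n. \<forall>p. free_act a p = 0} :: 'a nh_free set"
  have "ideal ?I (free_alg n)"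
  proof (rule ideal_free_algI)
    show "x * a \<in> ?I" if "a \<in> ?I" "x \<in> fcar n" for a x
      using that free_act_PConst_mult[of x 0 0] by (auto simp: free_act_mult fcar_mult)
  qed (auto simp: free_act_add free_act_mult fcar_intros)
  moreover have "nh_rels n \<subseteq> ?I"
  proof (intro subsetI CollectI conjI allI)
    fix a :: "'a nh_free" and p :: "'a mpoly" assume a: "a \<in> nh_rels n"
    then show "a \<in> fcar n" using nh_rels_subset by blast
    have comm: "divided_diff r (divided_diff k p) = divided_diff k (divided_diff r p)"
      if "\<bar>int r - int k\<bar> > 1" for r k
      using that divided_diff_commute[of r k p] divided_diff_commute[of k r p]
      by (cases "r < k") auto
    from a show "free_act a p = 0"
      unfolding nh_rels_def
      by (auto simp: free_act_mult free_act_diff free_act_add divided_diff_divided_diff comm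
          divided_diff_braid divided_diff_PVar_mult mult.left_commute)
  qed
  ultimately show ?thesis
    using nh_ideal_minimal[of ?I n] assms by blast
qed

lemma nh_act_nh_class: "nh_act (nh_class n a) p = free_act a p"
proof -
  have all: "\<forall>b\<in>nh_class n a. free_act b p = free_act a p"
    by (auto simp: nh_class_eq free_act_add free_act_nh_ideal)
  have mem: "a \<in> nh_class n a"
    unfolding nh_class_eq using nh_ideal_0[of n] by force
  show ?thesis
    unfolding nh_act_def
  proof (rule the_equality)
    show "\<forall>b\<in>nh_class n a. free_act b p = free_act a p" by (rule all)
    show "g = free_act a p" if "\<forall>b\<in>nh_class n a. free_act b p = g" for g
      using bspec[OF that mem] by simp
  qed
qed

lemma free_act_polys: "a \<in> fcar n \<Longrightarrow> p \<in> polys {1..n} \<Longrightarrow> free_act a p \<in> polys {1..n}"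
proof (induction a rule: fcar_induct)
  case (gen g a)
  then show ?case
    by (auto simp: free_act_mult nh_gens_def simp del: One_nat_def
        intro!: divided_diff_polys polys_mult polys_PVar)
qed (auto simp: free_act_add intro: polys_mult polys_add)

text \<open>Congruence modulo the defining relations. Membership in the carrier is included so that
congruences can be chained and multiplied without further side conditions.\<close>

definition ideal_cong :: "nat \<Rightarrow> 'a::field nh_free \<Rightarrow> 'a nh_free \<Rightarrow> bool"
  where "ideal_cong n a b \<longleftrightarrow> a \<in> fcar n \<and> b \<in> fcar n \<and> a - b \<in> nh_ideal n"

lemma ideal_cong_refl: "a \<in> fcar n \<Longrightarrow> ideal_cong n a a"
  by (simp add: ideal_cong_def nh_ideal_0)

lemma ideal_cong_sym: "ideal_cong n a b \<Longrightarrow> ideal_cong n b a"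
  using nh_ideal_uminus[of "a - b" n] by (auto simp: ideal_cong_def)

lemma ideal_cong_trans [trans]: "ideal_cong n a b \<Longrightarrow> ideal_cong n b c \<Longrightarrow> ideal_cong n a c"
  using nh_ideal_add[of "a - b" n "b - c"] by (auto simp: ideal_cong_def)

lemma ideal_cong_add: "ideal_cong n a b \<Longrightarrow> ideal_cong n c d \<Longrightarrow> ideal_cong n (a + c) (b + d)"
  using nh_ideal_add[of "a - b" n "c - d"] by (auto simp: ideal_cong_def fcar_add algebra_simps)

lemma ideal_cong_mult: 
  assumes "ideal_cong n a b" "ideal_cong n c d"
  shows "ideal_cong n (a * c) (b * d)"
proof -
  have "a * c - b * d = (a - b) * c + b * (c - d)"
    by (simp add: algebra_simps)
  also have "\<dots> \<in> nh_ideal n"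
    using assms by (intro nh_ideal_add nh_ideal_mult_left nh_ideal_mult_right) (auto simp: ideal_cong_def)
  finally show ?thesis using assms by (auto simp: ideal_cong_def fcar_mult)
qed

lemma ideal_cong_mult_left: "c \<in> fcar n \<Longrightarrow> ideal_cong n a b \<Longrightarrow> ideal_cong n (c * a) (c * b)"
  by (intro ideal_cong_mult ideal_cong_refl)

lemma ideal_cong_mult_right: "c \<in> fcar n \<Longrightarrow> ideal_cong n a b \<Longrightarrow> ideal_cong n (a * c) (b * c)"
  by (intro ideal_cong_mult ideal_cong_refl)

lemma ideal_cong_imp_class_eq: "ideal_cong n a b \<Longrightarrow> nh_class n a = nh_class n b"
  by (simp add: ideal_cong_def nh_class_eq_iff)

lemma ideal_cong_fy_commute:
  assumes "j \<in> {1..n}" "k \<in> {1..n}"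
  shows "ideal_cong n (fy j * fy k :: 'a::field nh_free) (fy k * fy j)"
proof -
  have "(fy j * fy k - fy k * fy j :: 'a nh_free) \<in> nh_rels n"
    using assms unfolding nh_rels_def by blast
  then show ?thesis
    using assms by (simp add: ideal_cong_def nh_ideal_rels fcar_mult fcar_fy del: One_nat_def)
qed

lemma ideal_cong_fy_power_commute:
  assumes "j \<in> {1..n}" "k \<in> {1..n}"
  shows "ideal_cong n (fy j ^ e * fy k :: 'a::field nh_free) (fy k * fy j ^ e)"
proof (induction e)
  case 0
  then show ?case using assms by (simp add: ideal_cong_refl fcar_fy)
next
  case (Suc e)
  have "ideal_cong n (fy j ^ Suc e * fy k :: 'a nh_free) (fy j * (fy k * fy j ^ e))"
    using ideal_cong_mult_left[OF fcar_fy[OF assms(1)] Suc] by (simp add: mult.assoc)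
  also have "ideal_cong n (fy j * (fy k * fy j ^ e) :: 'a nh_free) (fy k * fy j ^ Suc e)"
    using ideal_cong_mult_right[OF fcar_power[OF fcar_fy[OF assms(1)]] ideal_cong_fy_commute[OF assms], of e]
    by (simp add: mult.assoc)
  finally show ?case .
qed

definition fymon :: "nat \<Rightarrow> (nat \<Rightarrow> nat) \<Rightarrow> 'a::field nh_free"
  where "fymon n e = prod_list (map (\<lambda>k. fy k ^ e k) [1..<n + 1])"

text \<open>Evaluation of a polynomial at \<open>x\<^sub>k = y\<^sub>k\<close> on representatives: the ordered monomials serve as a section
of the free algebra over the polynomials, which is multiplicative only modulo the relations.\<close>

definition feval :: "nat \<Rightarrow> 'a::field mpoly \<Rightarrow> 'a nh_free"
  where "feval n p = (\<Sum>m\<in>Poly_Mapping.keys p. fconst (Poly_Mapping.lookup p m) * fymon n (Poly_Mapping.lookup m))"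

lemma fcar_fymon: "fymon n e \<in> fcar n"
  unfolding fymon_def by (intro fcar_prod_list) (auto intro!: fcar_power fcar_fy)

lemma fcar_feval: "feval n p \<in> fcar n"
  unfolding feval_def by (intro fcar_intros fcar_fymon)

lemma nh_class_fymon: "nh_class n (fymon n e) = nh_ymonom n e"
  unfolding fymon_def nh_ymonom_def
  by (subst nh_class_prod_list)
    (auto simp: fcar_power fcar_fy nh_class_power nh_y_def o_def intro!: arg_cong[of _ _ "nh_prod_list n"])

lemma nh_class_feval: "nh_class n (feval n p) = nh_eval n p"
  unfolding feval_def nh_eval_def
  by (subst nh_class_sum)
    (auto simp: nh_class_mult nh_class_fymon fcar_fymon nh_const_def fcar_mult)

lemma feval_add: "feval n (p + q) = feval n p + feval n q"
  unfolding feval_def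
  by (rule setsum_keys_plus_distrib) (simp_all add: fconst_add distrib_right)

lemma feval_0 [simp]: "feval n 0 = 0"
  by (simp add: feval_def)

lemma feval_single: "feval n (Poly_Mapping.single m c) = fconst c * fymon n (Poly_Mapping.lookup m)"
  by (simp add: feval_def)

lemma feval_PConst_mult: "feval n (PConst c * p) = fconst c * feval n p"
  by (rule poly_mapping_single_induct[of "\<lambda>p. feval n (PConst c * p) = fconst c * feval n p"])
    (simp_all add: PConst_mult_single feval_single fconst_mult mult.assoc feval_add distrib_left)

lemma fymon_0 [simp]: "fymon n (\<lambda>k. 0) = 1"
proof -
  have "prod_list (map (\<lambda>k. 1) xs) = (1 :: 'a nh_free)" for xs :: "nat list"
    by (induction xs) simp_all
  then show ?thesis by (simp add: fymon_def)
qed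

lemma feval_PConst: "feval n (PConst c) = fconst c"
  by (simp add: PConst_def feval_single lookup_zero[abs_def])

lemma feval_1 [simp]: "feval n 1 = 1"
  using feval_PConst[of n 1] by simp

text \<open>The extra factor is moved to the front past the powers of the earlier generators.\<close>

lemma ideal_cong_fy_prod_list:
  assumes "k \<in> set xs" "distinct xs" "set xs \<subseteq> {1..n}"
  shows "ideal_cong n (prod_list (map (\<lambda>j. fy j ^ (if j = k then Suc (e j) else e j)) xs) :: 'a::field nh_free)
    (fy k * prod_list (map (\<lambda>j. fy j ^ e j) xs))"
  using assms
proof (induction xs)
  case (Cons x xs)
  let ?P = "\<lambda>xs. prod_list (map (\<lambda>j. fy j ^ e j) xs) :: 'a nh_free"
  let ?Q = "\<lambda>xs. prod_list (map (\<lambda>j. fy j ^ (if j = k then Suc (e j) else e j)) xs) :: 'a nh_free"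
  have x: "(fy x :: 'a nh_free) \<in> fcar n" and P: "?P xs \<in> fcar n"
    using Cons.prems(3) by (auto simp: subset_iff intro!: fcar_fy fcar_prod_list fcar_power)
  show ?case
  proof (cases "x = k")
    case True
    then have "?Q xs = ?P xs"
      using Cons.prems(2) by (intro arg_cong[of _ _ prod_list] map_cong) auto
    then show ?thesis
      using True x P by (auto simp: mult.assoc intro!: ideal_cong_refl fcar_mult fcar_power)
  next
    case False
    then have "ideal_cong n (?Q xs) (fy k * ?P xs)"
      using Cons by auto
    from ideal_cong_mult_left[OF fcar_power[OF x] this]
    have "ideal_cong n (?Q (x # xs)) (fy x ^ e x * fy k * ?P xs)"
      using False by (simp add: mult.assoc)
    also have "ideal_cong n (fy x ^ e x * fy k * ?P xs) (fy k * fy x ^ e x * ?P xs)"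
      using Cons.prems by (intro ideal_cong_mult_right[OF P] ideal_cong_fy_power_commute) auto
    finally show ?thesis by (simp add: mult.assoc)
  qed
qed simp

lemma ideal_cong_fymon_Suc:
  assumes "k \<in> {1..n}"
  shows "ideal_cong n (fymon n (Poly_Mapping.lookup (Poly_Mapping.single k 1 + m)) :: 'a::field nh_free)
    (fy k * fymon n (Poly_Mapping.lookup m))"
proof -
  have k: "k \<in> set [1..<n + 1]" "set [1..<n + 1] \<subseteq> {1..n}"
    using assms by auto
  have "Poly_Mapping.lookup (Poly_Mapping.single k 1 + m) j =
      (if j = k then Suc (Poly_Mapping.lookup m j) else Poly_Mapping.lookup m j)" for j
    by (simp add: lookup_add lookup_single when_def)
  then show ?thesis
    unfolding fymon_def using ideal_cong_fy_prod_list[OF k(1) distinct_upt k(2)]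
    by (simp del: upt_Suc One_nat_def)
qed

lemma ideal_cong_feval_PVar_mult:
  fixes p :: "'a::field mpoly"
  assumes k: "k \<in> {1..n}"
  shows "ideal_cong n (feval n (PVar k * p)) (fy k * feval n p)"
proof (rule poly_mapping_single_induct[of "\<lambda>p. ideal_cong n (feval n (PVar k * p)) (fy k * feval n p)"])
  show "ideal_cong n (feval n (PVar k * 0)) (fy k * feval n 0)"
    by (simp add: ideal_cong_refl)
  fix m and c :: 'a
  have "ideal_cong n (feval n (PVar k * Poly_Mapping.single m c)) (fconst c * (fy k * fymon n (Poly_Mapping.lookup m)))"
    unfolding PVar_mult_single feval_single
    by (intro ideal_cong_mult_left ideal_cong_fymon_Suc k fcar_fconst)
  then show "ideal_cong n (feval n (PVar k * Poly_Mapping.single m c)) (fy k * feval n (Poly_Mapping.single m c))"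
    using fconst_central[of c "fy k"] by (simp add: feval_single flip: mult.assoc)
next
  fix p q :: "'a mpoly"
  assume "ideal_cong n (feval n (PVar k * p)) (fy k * feval n p)" "ideal_cong n (feval n (PVar k * q)) (fy k * feval n q)"
  then show "ideal_cong n (feval n (PVar k * (p + q))) (fy k * feval n (p + q))"
    using ideal_cong_add by (fastforce simp: feval_add distrib_left)
qed

section \<open>Reduction modulo the one-sided ideals\<close>

text \<open>The three relations between \<open>\<psi>\<^sub>r\<close> and the \<open>y\<^sub>k\<close> in one formula: moving \<open>\<psi>\<^sub>r\<close> to the right applies the
transposition to the index and leaves a scalar.\<close>

lemma ideal_cong_fpsi_fy:
  assumes r: "r \<in> {1..<n}" and k: "k \<in> {1..n}"
  shows "ideal_cong n (fpsi r * fy k :: 'a::field nh_free)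
    (fy (adj r k) * fpsi r + fconst (if k = r then - 1 else if k = Suc r then 1 else 0))"
proof -
  have rel: "ideal_cong n a b" if "a \<in> fcar n" "b \<in> fcar n" "a - b \<in> nh_rels n \<or> b - a \<in> nh_rels n"
    for a b :: "'a nh_free"
    using that nh_ideal_rels[of "a - b" n] nh_ideal_uminus[OF nh_ideal_rels[of "b - a" n]]
    by (auto simp: ideal_cong_def)
  have car: "(fy (adj r k) :: 'a nh_free) \<in> fcar n"
    using r k by (intro fcar_fy) (auto simp: transpose_def)
  consider "k = r" | "k = Suc r" | "k \<noteq> r" "k \<noteq> Suc r" by blast
  then show ?thesis
  proof cases
    case 1
    have "(fy (r + 1) * fpsi r - (fpsi r * fy r + 1) :: 'a nh_free) \<in> nh_rels n"
      using r unfolding nh_rels_def by blast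
    also have "fy (r + 1) * fpsi r - (fpsi r * fy r + 1) =
        fy (adj r k) * fpsi r + fconst (- 1) - fpsi r * fy k"
      using 1 by (simp add: fconst_uminus)
    finally show ?thesis
      using 1 r k car by (intro rel fcar_mult fcar_add fcar_fpsi fcar_fy fcar_fconst) auto
  next
    case 2
    have "(fpsi r * fy (r + 1) - (fy r * fpsi r + 1) :: 'a nh_free) \<in> nh_rels n"
      using r unfolding nh_rels_def by blast
    then show ?thesis
      using 2 r k car by (intro rel fcar_mult fcar_add fcar_fpsi fcar_fy fcar_fconst) auto
  next
    case 3
    have "(fpsi r * fy k - fy k * fpsi r :: 'a nh_free) \<in> nh_rels n"
      unfolding nh_rels_def
      by (rule UnI2, rule CollectI, rule exI[of _ r], rule exI[of _ k]) (use r k 3 in simp)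
    then have "ideal_cong n (fpsi r * fy k :: 'a nh_free) (fy k * fpsi r)"
      by (intro rel[OF fcar_mult[OF fcar_fpsi[OF r] fcar_fy[OF k]] fcar_mult[OF fcar_fy[OF k] fcar_fpsi[OF r]]] disjI1)
    then show ?thesis using 3 by simp
  qed
qed

text \<open>The same uniform shape as \<open>ideal_cong_fpsi_fy\<close>, with the same scalar.\<close>

lemma divided_diff_PVar_mult':
  "divided_diff r (PVar k * p) = PVar (adj r k) * divided_diff r p +
    PConst (if k = r then - 1 else if k = Suc r then 1 else 0) * p"
  by (auto simp: divided_diff_PVar_mult PConst_uminus)

text \<open>The commutation rule $\psi_r f(y) = (s_r f)(y)\,\psi_r + (\partial_r f)(y)$, obtained by moving
$\psi_r$ past one variable at a time.\<close>

lemma ideal_cong_fpsi_feval: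
  fixes p :: "'a::field mpoly"
  assumes r: "r \<in> {1..<n}" and p: "p \<in> polys {1..n}"
  shows "ideal_cong n (fpsi r * feval n p) (feval n (swp r p) * fpsi r + feval n (divided_diff r p))"
  using p
proof (induction p rule: polys_induct)
  case (const c)
  have "fpsi r * fconst c \<in> fcar n" by (intro fcar_mult fcar_fpsi fcar_fconst r)
  then show ?case
    by (simp add: feval_PConst fconst_central divided_diff_symmetric ideal_cong_refl)
next
  case (var k q)
  let ?c = "if k = r then - 1 else if k = Suc r then 1 else 0 :: 'a"
  let ?k = "adj r k"
  have k': "?k \<in> {1..n}" using r var(1) by (auto simp: transpose_def)
  have car: "(fpsi r :: 'a nh_free) \<in> fcar n" "(fy ?k :: 'a nh_free) \<in> fcar n"
    by (rule fcar_fpsi[OF r], rule fcar_fy[OF k'])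
  have "ideal_cong n (fpsi r * feval n (PVar k * q)) (fpsi r * (fy k * feval n q))"
    by (intro ideal_cong_mult_left car ideal_cong_feval_PVar_mult var)
  also have "fpsi r * (fy k * feval n q) = fpsi r * fy k * feval n q"
    by (simp add: mult.assoc)
  also have "ideal_cong n \<dots> ((fy ?k * fpsi r + fconst ?c) * feval n q)"
    by (intro ideal_cong_mult_right fcar_feval ideal_cong_fpsi_fy r var)
  also have "\<dots> = fy ?k * (fpsi r * feval n q) + fconst ?c * feval n q"
    by (simp add: distrib_right mult.assoc)
  also have "ideal_cong n \<dots>
      (fy ?k * (feval n (swp r q) * fpsi r + feval n (divided_diff r q)) + fconst ?c * feval n q)"
    by (intro ideal_cong_add ideal_cong_mult_left car var ideal_cong_refl fcar_mult fcar_fconst fcar_feval)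
  also have "\<dots> = (fy ?k * feval n (swp r q)) * fpsi r +
      (fy ?k * feval n (divided_diff r q) + fconst ?c * feval n q)"
    by (simp add: distrib_left mult.assoc)
  also have "ideal_cong n \<dots> (feval n (PVar ?k * swp r q) * fpsi r +
      (feval n (PVar ?k * divided_diff r q) + fconst ?c * feval n q))"
    by (intro ideal_cong_add ideal_cong_mult_right ideal_cong_sym[OF ideal_cong_feval_PVar_mult] k' car ideal_cong_refl fcar_mult fcar_fconst fcar_feval)
  also have "\<dots> = feval n (swp r (PVar k * q)) * fpsi r + feval n (divided_diff r (PVar k * q))"
    unfolding divided_diff_PVar_mult' by (simp add: perm_vars_mult feval_add feval_PConst_mult)
  finally show ?case .
next
  case (add p q)
  have "ideal_cong n (fpsi r * feval n p + fpsi r * feval n q)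
      (feval n (swp r p) * fpsi r + feval n (divided_diff r p) +
      (feval n (swp r q) * fpsi r + feval n (divided_diff r q)))"
    by (intro ideal_cong_add add)
  then show ?case
    by (simp add: feval_add perm_vars_add divided_diff_add algebra_simps)
qed

text \<open>The representatives of the elements of \<open>J_left n\<close>.\<close>

definition psi_left :: "nat \<Rightarrow> 'a::field nh_free set"
  where "psi_left n = {(\<Sum>s\<in>{1..<n}. h s * fpsi s) + u | h u. h \<in> {1..<n} \<rightarrow> fcar n \<and> u \<in> nh_ideal n}"

text \<open>The representatives of the elements of \<open>J_right n\<close>.\<close>

definition psi_right :: "nat \<Rightarrow> 'a::field nh_free set"
  where "psi_right n = {(\<Sum>s\<in>{1..<n}. fpsi s * h s) + u | h u. h \<in> {1..<n} \<rightarrow> fcar n \<and> u \<in> nh_ideal n}"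

lemma psi_leftI:
  "a = (\<Sum>s\<in>{1..<n}. h s * fpsi s) + u \<Longrightarrow> h \<in> {1..<n} \<rightarrow> fcar n \<Longrightarrow> u \<in> nh_ideal n \<Longrightarrow>
    a \<in> psi_left n"
  unfolding psi_left_def by blast

lemma psi_rightI:
  "a = (\<Sum>s\<in>{1..<n}. fpsi s * h s) + u \<Longrightarrow> h \<in> {1..<n} \<rightarrow> fcar n \<Longrightarrow> u \<in> nh_ideal n \<Longrightarrow>
    a \<in> psi_right n"
  unfolding psi_right_def by blast

lemma nh_ideal_psi_left: "a \<in> nh_ideal n \<Longrightarrow> a \<in> psi_left n"
  unfolding psi_left_def by (intro CollectI exI[of _ "\<lambda>_. 0"] exI[of _ a]) auto

lemma nh_ideal_psi_right: "a \<in> nh_ideal n \<Longrightarrow> a \<in> psi_right n"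
  unfolding psi_right_def by (intro CollectI exI[of _ "\<lambda>_. 0"] exI[of _ a]) auto

lemma psi_left_add:
  assumes "a \<in> psi_left n" "b \<in> psi_left n"
  shows "a + b \<in> psi_left n"
proof -
  obtain h u g v where hg: "h \<in> {1..<n} \<rightarrow> fcar n" "u \<in> nh_ideal n" "g \<in> {1..<n} \<rightarrow> fcar n" "v \<in> nh_ideal n"
    and ab: "a = (\<Sum>s\<in>{1..<n}. h s * fpsi s) + u" "b = (\<Sum>s\<in>{1..<n}. g s * fpsi s) + v"
    using assms unfolding psi_left_def by blast
  have "a + b = (\<Sum>s\<in>{1..<n}. (h s + g s) * fpsi s) + (u + v)"
    by (simp add: ab distrib_right sum.distrib)
  moreover have "(\<lambda>s. h s + g s) \<in> {1..<n} \<rightarrow> fcar n"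
    using hg(1,3) by (auto intro: fcar_add)
  ultimately show ?thesis
    using nh_ideal_add[OF hg(2,4)] by (rule psi_leftI)
qed

lemma psi_right_add:
  assumes "a \<in> psi_right n" "b \<in> psi_right n"
  shows "a + b \<in> psi_right n"
proof -
  obtain h u g v where hg: "h \<in> {1..<n} \<rightarrow> fcar n" "u \<in> nh_ideal n" "g \<in> {1..<n} \<rightarrow> fcar n" "v \<in> nh_ideal n"
    and ab: "a = (\<Sum>s\<in>{1..<n}. fpsi s * h s) + u" "b = (\<Sum>s\<in>{1..<n}. fpsi s * g s) + v"
    using assms unfolding psi_right_def by blast
  have "a + b = (\<Sum>s\<in>{1..<n}. fpsi s * (h s + g s)) + (u + v)"
    by (simp add: ab distrib_left sum.distrib)
  moreover have "(\<lambda>s. h s + g s) \<in> {1..<n} \<rightarrow> fcar n"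
    using hg(1,3) by (auto intro: fcar_add)
  ultimately show ?thesis
    using nh_ideal_add[OF hg(2,4)] by (rule psi_rightI)
qed

lemma psi_left_mult:
  assumes "c \<in> fcar n" "a \<in> psi_left n"
  shows "c * a \<in> psi_left n"
proof -
  obtain h u where h: "h \<in> {1..<n} \<rightarrow> fcar n" "u \<in> nh_ideal n"
    and a: "a = (\<Sum>s\<in>{1..<n}. h s * fpsi s) + u"
    using assms unfolding psi_left_def by blast
  have "c * a = (\<Sum>s\<in>{1..<n}. (c * h s) * fpsi s) + c * u"
    by (simp add: a distrib_left sum_distrib_left mult.assoc)
  moreover have "(\<lambda>s. c * h s) \<in> {1..<n} \<rightarrow> fcar n"
    using h(1) assms(1) by (auto intro: fcar_mult)
  ultimately show ?thesis
    using nh_ideal_mult_left[OF h(2) assms(1)] by (rule psi_leftI)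
qed

lemma mult_fpsi_psi_left:
  assumes "a \<in> fcar n" "r \<in> {1..<n}"
  shows "a * fpsi r \<in> psi_left n"
proof -
  have "a * fpsi r = (\<Sum>s\<in>{1..<n}. (if s = r then a else 0) * fpsi s)"
    using assms(2) by (subst sum.remove[of _ r]) auto
  moreover have "(\<lambda>s. if s = r then a else 0) \<in> {1..<n} \<rightarrow> fcar n"
    using assms(1) by auto
  ultimately show ?thesis
    unfolding psi_left_def using nh_ideal_0[of n]
    by (intro CollectI exI[of _ "\<lambda>s. if s = r then a else 0"] exI[of _ 0]) auto
qed

text \<open>Modulo the left ideal, the algebra acts on evaluated polynomials as in the polynomial representation.
For a generator \<open>\<psi>\<^sub>r\<close> the commutation rule leaves the error term $(s_r f)(y)\,\psi_r$, which lies in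
the left ideal; for \<open>y\<^sub>k\<close> there is no error beyond the defining relations.\<close>

theorem feval_free_act_cong:
  assumes "a \<in> fcar n" "p \<in> polys {1..n}"
  shows "a * feval n p - feval n (free_act a p) \<in> psi_left n"
  using assms
proof (induction a rule: fcar_induct)
  case (const c)
  then show ?case by (simp add: feval_PConst_mult nh_ideal_psi_left nh_ideal_0)
next
  case (gen g a)
  let ?q = "free_act a p"
  have q: "?q \<in> polys {1..n}" by (rule free_act_polys[OF gen(2,4)])
  have step: "fgen g * feval n ?q - feval n (gen_act g ?q) \<in> psi_left n"
  proof (cases g)
    case (GPsi r)
    then have r: "r \<in> {1..<n}" using gen(1) by (auto simp: nh_gens_def)
    have "fpsi r * feval n ?q - feval n (divided_diff r ?q) =
        (fpsi r * feval n ?q - (feval n (swp r ?q) * fpsi r + feval n (divided_diff r ?q))) +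
        feval n (swp r ?q) * fpsi r"
      by simp
    also have "\<dots> \<in> psi_left n"
      using ideal_cong_fpsi_feval[OF r q]
      by (intro psi_left_add nh_ideal_psi_left mult_fpsi_psi_left r fcar_feval) (simp add: ideal_cong_def)
    finally show ?thesis using GPsi by (simp add: fpsi_eq_fgen)
  next
    case (GY k)
    then have k: "k \<in> {1..n}" using gen(1) by (auto simp: nh_gens_def)
    show ?thesis
      using ideal_cong_sym[OF ideal_cong_feval_PVar_mult[OF k, of ?q]] GY
      by (simp add: fy_eq_fgen ideal_cong_def nh_ideal_psi_left)
  qed
  have "fgen g * a * feval n p - feval n (free_act (fgen g * a) p) =
      fgen g * (a * feval n p - feval n ?q) + (fgen g * feval n ?q - feval n (gen_act g ?q))"
    by (simp add: free_act_mult algebra_simps)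
  also have "\<dots> \<in> psi_left n"
    using gen by (intro psi_left_add psi_left_mult step fcar_fgen) auto
  finally show ?case .
next
  case (add a b)
  have "(a + b) * feval n p - feval n (free_act (a + b) p) =
      (a * feval n p - feval n (free_act a p)) + (b * feval n p - feval n (free_act b p))"
    by (simp add: free_act_add feval_add algebra_simps)
  then show ?case using psi_left_add[OF add(3,4)] add(5) by simp
qed

corollary feval_free_act_1_cong: "a \<in> fcar n \<Longrightarrow> a - feval n (free_act a 1) \<in> psi_left n"
  using feval_free_act_cong[of a n 1] by simp

text \<open>The elements for which the congruence \<open>feval_free_act_cong\<close> holds already modulo the defining
relations. They form a subalgebra containing the \<open>y\<^sub>k\<close>, and applying the condition to the polynomial
\<open>1\<close> shows that each of them is a polynomial in the \<open>y\<^sub>k\<close>.\<close>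

definition y_like :: "nat \<Rightarrow> 'a::field nh_free \<Rightarrow> bool"
  where "y_like n a \<longleftrightarrow> a \<in> fcar n \<and> (\<forall>p\<in>polys {1..n}. ideal_cong n (a * feval n p) (feval n (free_act a p)))"

lemma y_like_fconst: "y_like n (fconst c)"
  unfolding y_like_def by (auto simp: feval_PConst_mult intro!: ideal_cong_refl fcar_mult fcar_fconst fcar_feval)

lemma y_like_1: "y_like n 1"
  using y_like_fconst[of n 1] by simp

lemma y_like_fy: "k \<in> {1..n} \<Longrightarrow> y_like n (fy k)"
  unfolding y_like_def by (auto simp del: One_nat_def intro!: ideal_cong_sym[OF ideal_cong_feval_PVar_mult] fcar_fy)

lemma y_like_add: "y_like n a \<Longrightarrow> y_like n b \<Longrightarrow> y_like n (a + b)"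
  unfolding y_like_def by (auto simp: distrib_right free_act_add feval_add intro!: ideal_cong_add fcar_add)

lemma y_like_mult:
  assumes a: "y_like n a" and b: "y_like n b"
  shows "y_like n (a * b)"
  unfolding y_like_def
proof (intro conjI ballI)
  have car: "a \<in> fcar n" "b \<in> fcar n" using a b by (auto simp: y_like_def)
  then show "a * b \<in> fcar n" by (rule fcar_mult)
  fix p :: "'a mpoly" assume p: "p \<in> polys {1..n}"
  have "ideal_cong n (a * b * feval n p) (a * feval n (free_act b p))"
    unfolding mult.assoc by (intro ideal_cong_mult_left car) (use b p in \<open>simp add: y_like_def\<close>)
  also have "ideal_cong n (a * feval n (free_act b p)) (feval n (free_act (a * b) p))"
    using a free_act_polys[OF car(2) p] by (simp add: y_like_def free_act_mult)
  finally show "ideal_cong n (a * b * feval n p) (feval n (free_act (a * b) p))" .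
qed

lemma y_like_uminus: "y_like n a \<Longrightarrow> y_like n (- a)"
  using y_like_mult[OF y_like_fconst[of n "- 1"]] by (fastforce simp: fconst_uminus)

lemma y_like_power: "y_like n a \<Longrightarrow> y_like n (a ^ k)"
  by (induction k) (simp_all add: y_like_1 y_like_mult)

lemma y_like_prod_list: "(\<And>a. a \<in> set as \<Longrightarrow> y_like n a) \<Longrightarrow> y_like n (prod_list as)"
  by (induction as) (simp_all add: y_like_1 y_like_mult)

lemma y_like_imp_feval: "y_like n a \<Longrightarrow> ideal_cong n a (feval n (free_act a 1))"
  unfolding y_like_def by (auto dest: bspec[of _ _ 1])

lemma nh_ysubalg_imp_eval:
  assumes "z \<in> nh_ysubalg n"
  shows "\<exists>p\<in>polys {1..n}. z = nh_class n (feval n p)"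
proof -
  have "\<exists>a. y_like n a \<and> z = nh_class n a"
    using assms unfolding nh_ysubalg_def
  proof (induction rule: generate_ring.induct)
    case one
    show ?case using y_like_1[of n] nh_class_1[of n] by metis
  next
    case (incl h)
    then show ?case
      using y_like_fconst[of n] y_like_fy[of _ n] unfolding nh_const_def nh_y_def by fastforce
  next
    case (a_inv h)
    then show ?case using y_like_uminus nh_class_uminus unfolding y_like_def by metis
  next
    case (eng_add h1 h2)
    then obtain a b where "y_like n a" "h1 = nh_class n a" "y_like n b" "h2 = nh_class n b" by blast
    then show ?case
      by (intro exI[of _ "a + b"]) (auto simp: y_like_add nh_class_add y_like_def[of n a] y_like_def[of n b])
  next
    case (eng_mult h1 h2)
    then obtain a b where "y_like n a" "h1 = nh_class n a" "y_like n b" "h2 = nh_class n b" by blast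
    then show ?case
      by (intro exI[of _ "a * b"]) (auto simp: y_like_mult nh_class_mult y_like_def[of n a] y_like_def[of n b])
  qed
  then obtain a where a: "y_like n a" "z = nh_class n a" by blast
  then have "z = nh_class n (feval n (free_act a 1))"
    using ideal_cong_imp_class_eq[OF y_like_imp_feval] by blast
  moreover have "free_act a 1 \<in> polys {1..n}"
    using a by (intro free_act_polys) (auto simp: y_like_def)
  ultimately show ?thesis by blast
qed

lemma nh_class_feval_ysubalg: "nh_class n (feval n p) \<in> nh_ysubalg n"
proof -
  let ?Y = "generate_ring (nilHecke n) (range (nh_const n) \<union> nh_y n ` {1..n}) :: 'a nh_free set set"
  have const: "nh_class n (fconst c) \<in> ?Y" for c
    by (rule generate_ring.incl) (simp add: nh_const_def)
  have y: "nh_class n (fy k) \<in> ?Y" if "k \<in> {1..n}" for k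
    using that by (intro generate_ring.incl) (simp add: nh_y_def)
  have mult: "nh_class n (a * b) \<in> ?Y" if "nh_class n a \<in> ?Y" "nh_class n b \<in> ?Y" "a \<in> fcar n" "b \<in> fcar n" for a b
    using that by (simp add: nh_class_mult generate_ring.eng_mult)
  have one: "nh_class n 1 \<in> ?Y" using const[of 1] by simp
  have power: "nh_class n (fy k ^ e) \<in> ?Y" if "k \<in> {1..n}" for k e
    by (induction e) (use that in \<open>auto simp del: One_nat_def intro!: one mult y fcar_power fcar_fy\<close>)
  have list: "nh_class n (prod_list (map (\<lambda>k. fy k ^ e k) xs)) \<in> ?Y"
    if "set xs \<subseteq> {1..n}" for e and xs :: "nat list"
    using that
    by (induction xs) (auto simp del: One_nat_def simp: subset_iff intro!: one mult power fcar_power fcar_fy fcar_prod_list)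
  have mon: "nh_class n (fymon n e) \<in> ?Y" for e
    unfolding fymon_def by (rule list) auto
  show ?thesis
    unfolding nh_ysubalg_def
  proof (rule poly_mapping_single_induct[of "\<lambda>p. nh_class n (feval n p) \<in> ?Y"])
    show "nh_class n (feval n 0) \<in> ?Y" using const[of 0] by simp
    show "nh_class n (feval n (Poly_Mapping.single m c)) \<in> ?Y" for m c
      unfolding feval_single by (intro mult const mon fcar_fconst fcar_fymon)
  qed (simp add: feval_add nh_class_add fcar_feval generate_ring.eng_add)
qed

lemma J_left_eq: "J_left n = nh_class n ` psi_left n"
proof
  show "nh_class n ` psi_left n \<subseteq> J_left n"
  proof
    fix x assume "x \<in> nh_class n ` psi_left n"
    then obtain h u where h: "h \<in> {1..<n} \<rightarrow> fcar n" "u \<in> nh_ideal n"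
      and x: "x = nh_class n ((\<Sum>s\<in>{1..<n}. h s * fpsi s) + u)"
      unfolding psi_left_def by blast
    have "x = nh_class n (\<Sum>s\<in>{1..<n}. h s * fpsi s)"
      unfolding x nh_class_eq_iff using h(2) by simp
    also have "\<dots> = (\<Oplus>\<^bsub>nilHecke n\<^esub>s\<in>{1..<n}. nh_class n (h s * fpsi s))"
      using h(1) by (intro nh_class_sum) (auto simp del: One_nat_def intro!: fcar_mult fcar_fpsi)
    also have "\<dots> = (\<Oplus>\<^bsub>nilHecke n\<^esub>s\<in>{1..<n}. nh_class n (h s) \<otimes>\<^bsub>nilHecke n\<^esub> nh_psi n s)"
    proof -
      interpret ring "nilHecke n" by (rule ring_nilHecke)
      show ?thesis
        using h(1) by (intro finsum_cong')
          (auto simp: nh_class_mult[OF funcset_mem[OF h(1)] fcar_fpsi] nh_psi_def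
            simp del: One_nat_def intro!: m_closed nh_class_closed fcar_fpsi)
    qed
    finally show "x \<in> J_left n"
      unfolding J_left_def using h(1) nh_class_closed[of _ n]
      by (intro CollectI exI[of _ "\<lambda>s. nh_class n (h s)"]) auto
  qed
  show "J_left n \<subseteq> nh_class n ` psi_left n"
  proof
    fix x assume "x \<in> J_left n"
    then obtain h where h: "h \<in> {1..<n} \<rightarrow> carrier (nilHecke n)"
      and x: "x = (\<Oplus>\<^bsub>nilHecke n\<^esub>s\<in>{1..<n}. h s \<otimes>\<^bsub>nilHecke n\<^esub> nh_psi n s)"
      unfolding J_left_def by blast
    have "\<forall>s\<in>{1..<n}. \<exists>a. a \<in> fcar n \<and> h s = nh_class n a"
      using h nilHecke_carrier by blast
    then obtain g where g: "\<And>s. s \<in> {1..<n} \<Longrightarrow> g s \<in> fcar n \<and> h s = nh_class n (g s)"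
      by (metis bchoice)
    have "x = (\<Oplus>\<^bsub>nilHecke n\<^esub>s\<in>{1..<n}. nh_class n (g s * fpsi s))"
    proof -
      interpret ring "nilHecke n" by (rule ring_nilHecke)
      show ?thesis
        unfolding x using g by (intro finsum_cong')
          (auto simp: nh_class_mult nh_psi_def fcar_fpsi nh_class_closed simp del: One_nat_def
            intro!: nh_class_closed fcar_mult)
    qed
    also have "\<dots> = nh_class n ((\<Sum>s\<in>{1..<n}. g s * fpsi s) + 0)"
      using g unfolding add_0_right
      by (intro nh_class_sum[symmetric]) (auto simp del: One_nat_def intro!: fcar_mult fcar_fpsi)
    also have "\<dots> \<in> nh_class n ` psi_left n"
      unfolding psi_left_def using g nh_ideal_0[of n] by blast
    finally show "x \<in> nh_class n ` psi_left n" .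
  qed
qed

lemma psi_right_J_right: "a \<in> psi_right n \<Longrightarrow> nh_class n a \<in> J_right n"
proof -
  assume "a \<in> psi_right n"
  then obtain h u where h: "h \<in> {1..<n} \<rightarrow> fcar n" "u \<in> nh_ideal n"
    and a: "a = (\<Sum>s\<in>{1..<n}. fpsi s * h s) + u"
    unfolding psi_right_def by blast
  have "nh_class n a = nh_class n (\<Sum>s\<in>{1..<n}. fpsi s * h s)"
    unfolding a nh_class_eq_iff using h(2) by simp
  also have "\<dots> = (\<Oplus>\<^bsub>nilHecke n\<^esub>s\<in>{1..<n}. nh_class n (fpsi s * h s))"
    using h(1) by (intro nh_class_sum) (auto simp del: One_nat_def intro!: fcar_mult fcar_fpsi)
  also have "\<dots> = (\<Oplus>\<^bsub>nilHecke n\<^esub>s\<in>{1..<n}. nh_psi n s \<otimes>\<^bsub>nilHecke n\<^esub> nh_class n (h s))"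
  proof -
    interpret ring "nilHecke n" by (rule ring_nilHecke)
    show ?thesis
      using h(1) by (intro finsum_cong')
        (auto simp: nh_class_mult[OF fcar_fpsi funcset_mem[OF h(1)]] nh_psi_def
          simp del: One_nat_def intro!: m_closed nh_class_closed fcar_fpsi)
  qed
  finally show "nh_class n a \<in> J_right n"
    unfolding J_right_def using h(1) nh_class_closed[of _ n]
    by (intro CollectI exI[of _ "\<lambda>s. nh_class n (h s)"]) auto
qed

lemma free_act_psi_left_1:
  assumes "a \<in> psi_left n"
  shows "free_act a 1 = 0"
proof -
  obtain h u where u: "u \<in> nh_ideal n" and a: "a = (\<Sum>s\<in>{1..<n}. h s * fpsi s) + u"
    using assms unfolding psi_left_def by blast
  have "free_act (h s) 0 = 0" for s
    using free_act_PConst_mult[of "h s" 0 0] by simp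
  then show ?thesis
    by (simp add: a free_act_add free_act_sum free_act_mult free_act_nh_ideal[OF u] divided_diff_symmetric)
qed

text \<open>The left ideal annihilates the polynomial \<open>1\<close>, so congruent elements agree on it.\<close>

lemma eval_cong_J_left_unique:
  assumes "a \<in> fcar n" and "p \<in> polys {1..n}"
    and "nh_cong n (nh_class n a) (nh_class n (feval n p)) (J_left n)"
  shows "free_act a 1 = free_act (feval n p) 1"
proof -
  have "nh_class n (a - feval n p) \<in> J_left n"
    using assms by (simp add: nh_cong_def nh_class_diff fcar_feval)
  then obtain b where b: "b \<in> psi_left n" "nh_class n (a - feval n p) = nh_class n b"
    unfolding J_left_eq by blast
  have "free_act (a - feval n p - b) 1 = 0"
    using b(2) by (intro free_act_nh_ideal) (simp add: nh_class_eq_iff)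
  then show ?thesis
    using free_act_psi_left_1[OF b(1)] by (simp add: free_act_diff)
qed

lemma free_act_fy_power [simp]: "free_act (fy k ^ e) p = PVar k ^ e * p"
  by (induction e) (simp_all add: free_act_mult mult.assoc)

lemma free_act_y_prod_list:
  "free_act (prod_list (map (\<lambda>k. fy k ^ e k) xs)) p = prod_list (map (\<lambda>k. PVar k ^ e k) xs) * p"
  by (induction xs) (simp_all add: free_act_mult mult.assoc)

lemma free_act_fymon: "free_act (fymon n e) p = xmonom n e * p"
proof -
  have "prod_list (map (\<lambda>k. PVar k ^ e k :: 'a mpoly) [1..<n + 1]) = xmonom n e"
    unfolding xmonom_def
    by (subst prod.distinct_set_conv_list[symmetric]) (auto intro: prod.cong)
  then show ?thesis by (simp add: fymon_def free_act_y_prod_list)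
qed

lemma fymon_cong: "(\<And>k. k \<in> {1..n} \<Longrightarrow> e k = e' k) \<Longrightarrow> fymon n e = fymon n e'"
  unfolding fymon_def by (intro arg_cong[of _ _ prod_list] map_cong) auto

lemma feval_xmonom: "feval n (xmonom n e) = fymon n e"
  by (simp add: xmonom_eq_single feval_single, rule fymon_cong) (simp add: lookup_expvec)

text \<open>Acting on \<open>1\<close> recovers a polynomial from its evaluation; in particular the \<open>y\<^sub>k\<close> are algebraically
independent.\<close>

lemma free_act_feval:
  assumes "p \<in> polys {1..n}"
  shows "free_act (feval n p) 1 = p"
proof -
  have single: "free_act (feval n (Poly_Mapping.single m c)) 1 = Poly_Mapping.single m c"
    if "Poly_Mapping.keys m \<subseteq> {1..n}" for m and c :: 'a
  proof -
    have "expvec n (Poly_Mapping.lookup m) = m"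
      using that by (intro poly_mapping_eqI) (auto simp: lookup_expvec in_keys_iff subset_iff)
    then show ?thesis
      by (simp add: feval_single free_act_mult free_act_fymon xmonom_eq_single PConst_mult_single)
  qed
  show ?thesis
  proof (rule poly_mapping_single_induct[of "\<lambda>p. free_act (feval n p) 1 = p"])
    fix m and c :: 'a assume "m \<in> Poly_Mapping.keys p"
    then show "free_act (feval n (Poly_Mapping.single m c)) 1 = Poly_Mapping.single m c"
      using assms by (intro single) (simp add: polys_def)
  qed (simp_all add: feval_add free_act_add)
qed

section \<open>Reversal of words and the theorem\<close>

definition reverse_word :: "nh_word \<Rightarrow> nh_word"
  where "reverse_word w = Word (rev (letters w))"

text \<open>The anti-automorphism of the free algebra that reverses words and fixes the generators.\<close>

definition frev :: "'a::field nh_free \<Rightarrow> 'a nh_free"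
  where "frev = Poly_Mapping.map_key reverse_word"

lemma reverse_word_reverse_word [simp]: "reverse_word (reverse_word w) = w"
  by (simp add: reverse_word_def)

lemma inj_reverse_word: "inj reverse_word"
  by (metis injI reverse_word_reverse_word)

lemma reverse_word_add: "reverse_word (u + v) = reverse_word v + reverse_word u"
  by (simp add: reverse_word_def plus_nh_word_def)

lemma frev_single: "frev (Poly_Mapping.single w c) = Poly_Mapping.single (reverse_word w) c"
  using map_key_single[OF inj_reverse_word, of "reverse_word w" c] by (simp add: frev_def)

lemma frev_0 [simp]: "frev 0 = 0"
  by (simp add: frev_def map_key_zero[OF inj_reverse_word])

lemma frev_add: "frev (a + b) = frev a + frev b"
  by (simp add: frev_def map_key_plus[OF inj_reverse_word])

lemma frev_mult: "frev (a * b) = frev b * frev a"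
proof -
  have single: "frev (Poly_Mapping.single w c * b) = frev b * frev (Poly_Mapping.single w c)" for w c
    by (rule poly_mapping_single_induct[of "\<lambda>b. frev (Poly_Mapping.single w c * b) =
          frev b * frev (Poly_Mapping.single w c)"])
      (simp_all add: mult_single frev_single reverse_word_add frev_add distrib_left distrib_right mult.commute)
  show ?thesis
    by (rule poly_mapping_single_induct[of "\<lambda>a. frev (a * b) = frev b * frev a"])
      (simp_all add: single frev_add distrib_left distrib_right)
qed

lemma frev_frev [simp]: "frev (frev a) = a"
  by (rule poly_mapping_single_induct[of "\<lambda>a. frev (frev a) = a"])
    (simp_all add: frev_single frev_add)

lemma frev_fconst [simp]: "frev (fconst c) = fconst c"
  by (simp add: fconst_def frev_single reverse_word_def zero_nh_word_def)

lemma frev_1 [simp]: "frev 1 = 1"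
  using frev_fconst[of 1] by simp

lemma frev_fgen [simp]: "frev (fgen g) = fgen g"
  by (simp add: fgen_def frev_single reverse_word_def)

lemma frev_fpsi [simp]: "frev (fpsi r) = fpsi r" and frev_fy [simp]: "frev (fy k) = fy k"
  by (simp_all add: fpsi_eq_fgen fy_eq_fgen)

lemma frev_uminus: "frev (- a) = - frev a"
  using frev_mult[of "fconst (- 1)" a] unfolding frev_fconst by (simp add: fconst_uminus)

lemma frev_diff: "frev (a - b) = frev a - frev b"
  using frev_add[of a "- b"] by (simp add: frev_uminus)

lemma frev_sum: "frev (sum f A) = (\<Sum>i\<in>A. frev (f i))"
  by (induction A rule: infinite_finite_induct) (simp_all add: frev_add)

lemma frev_power: "frev (a ^ k) = frev a ^ k"
  by (induction k) (simp_all add: frev_mult power_commutes)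

lemma frev_prod_list: "frev (prod_list as) = prod_list (rev (map frev as))"
  by (induction as) (simp_all add: frev_mult)

lemma fcar_frev: "a \<in> fcar n \<Longrightarrow> frev a \<in> fcar n"
  by (induction a rule: fcar_induct) (auto simp: frev_mult frev_add fcar_mult fcar_fgen fcar_add)

text \<open>Word reversal sends every defining relation to a defining relation up to sign; it exchanges the two
mixed relations \<open>\<psi>\<^sub>r y\<^bsub>r+1\<^esub> = y\<^sub>r \<psi>\<^sub>r + 1\<close> and \<open>y\<^bsub>r+1\<^esub> \<psi>\<^sub>r = \<psi>\<^sub>r y\<^sub>r + 1\<close>.\<close>

lemma frev_nh_ideal:
  assumes "a \<in> nh_ideal n"
  shows "frev a \<in> nh_ideal n"
proof -
  let ?I = "{a \<in> fcar n. frev a \<in> nh_ideal n} :: 'a nh_free set"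
  have "ideal ?I (free_alg n)"
    by (rule ideal_free_algI)
      (auto simp: nh_ideal_0 frev_add frev_mult fcar_add fcar_mult fcar_frev nh_ideal_add
        nh_ideal_mult_left nh_ideal_mult_right)
  moreover have "nh_rels n \<subseteq> ?I"
  proof
    fix a :: "'a nh_free" assume a: "a \<in> nh_rels n"
    then have "frev a \<in> nh_rels n \<or> - frev a \<in> nh_rels n"
    proof -
      have rel: ?thesis if "b \<in> nh_rels n" "frev a = b \<or> frev a = - b" for b
        using that by auto
      show ?thesis
        using a[unfolded nh_rels_def]
      proof (elim UnE CollectE exE conjE)
        fix r assume "a = fpsi r * fpsi r" "r \<in> {1..<n}"
        then show ?thesis
          by (intro rel[OF a]) (simp add: frev_mult)
      next
        fix r k assume "a = fpsi r * fpsi k - fpsi k * fpsi r"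
        then show ?thesis
          by (intro rel[OF a]) (simp add: frev_mult frev_diff)
      next
        fix r assume "a = fpsi r * fpsi (r + 1) * fpsi r - fpsi (r + 1) * fpsi r * fpsi (r + 1)"
        then show ?thesis
          by (intro rel[OF a]) (simp add: frev_mult frev_diff mult.assoc)
      next
        fix r k assume "a = fy r * fy k - fy k * fy r"
        then show ?thesis
          by (intro rel[OF a]) (simp add: frev_mult frev_diff)
      next
        fix r assume r: "a = fpsi r * fy (r + 1) - (fy r * fpsi r + 1)" "r \<in> {1..<n}"
        have "(fy (r + 1) * fpsi r - (fpsi r * fy r + 1) :: 'a nh_free) \<in> nh_rels n"
          using r(2) unfolding nh_rels_def by blast
        then show ?thesis
          using r(1) by (intro rel) (auto simp: frev_mult frev_diff frev_add)
      next
        fix r assume r: "a = fy (r + 1) * fpsi r - (fpsi r * fy r + 1)" "r \<in> {1..<n}"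
        have "(fpsi r * fy (r + 1) - (fy r * fpsi r + 1) :: 'a nh_free) \<in> nh_rels n"
          using r(2) unfolding nh_rels_def by blast
        then show ?thesis
          using r(1) by (intro rel) (auto simp: frev_mult frev_diff frev_add)
      next
        fix r k assume "a = fpsi r * fy k - fy k * fpsi r"
        then show ?thesis
          by (intro rel[OF a]) (simp add: frev_mult frev_diff)
      qed
    qed
    then have "frev a \<in> nh_ideal n"
      using nh_ideal_rels[of "frev a" n] nh_ideal_uminus[OF nh_ideal_rels[of "- frev a" n]] by auto
    moreover have "a \<in> fcar n" using a nh_rels_subset by blast
    ultimately show "a \<in> ?I" by simp
  qed
  ultimately show ?thesis
    using nh_ideal_minimal[of ?I n] assms by blast
qed

lemma frev_psi_left: "a \<in> psi_left n \<Longrightarrow> frev a \<in> psi_right n"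
proof -
  assume "a \<in> psi_left n"
  then obtain h u where h: "h \<in> {1..<n} \<rightarrow> fcar n" "u \<in> nh_ideal n"
    and a: "a = (\<Sum>s\<in>{1..<n}. h s * fpsi s) + u"
    unfolding psi_left_def by blast
  have "frev a = (\<Sum>s\<in>{1..<n}. fpsi s * frev (h s)) + frev u"
    by (simp add: a frev_add frev_sum frev_mult)
  moreover have "(\<lambda>s. frev (h s)) \<in> {1..<n} \<rightarrow> fcar n"
    using h(1) by (auto intro: fcar_frev)
  ultimately show ?thesis
    using frev_nh_ideal[OF h(2)] by (rule psi_rightI)
qed

lemma frev_fymon: "frev (fymon n e) = prod_list (map (\<lambda>k. fy k ^ e k) (rev [1..<n + 1]))"
  by (simp add: fymon_def frev_prod_list rev_map frev_power o_def del: upt_Suc)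

lemma free_act_frev_fymon: "free_act (frev (fymon n e)) p = xmonom n e * p"
proof -
  have "prod_list (map (\<lambda>k. PVar k ^ e k :: 'a mpoly) (rev [1..<n + 1])) = xmonom n e"
    unfolding xmonom_def
    by (subst prod.distinct_set_conv_list[symmetric]) (auto intro: prod.cong)
  then show ?thesis by (simp only: frev_fymon free_act_y_prod_list)
qed

text \<open>Reversing an ordered monomial permutes commuting factors. Instead of sorting them, both sides are
identified through their action on \<open>1\<close>.\<close>

lemma ideal_cong_frev_fymon: "ideal_cong n (frev (fymon n e)) (fymon n e)"
proof -
  have "y_like n (frev (fymon n e))"
    unfolding frev_fymon by (rule y_like_prod_list) (auto simp del: One_nat_def upt_Suc intro!: y_like_power y_like_fy)
  then have "ideal_cong n (frev (fymon n e)) (feval n (free_act (frev (fymon n e)) 1))"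
    by (rule y_like_imp_feval)
  then show ?thesis
    by (simp add: free_act_frev_fymon feval_xmonom)
qed

lemma ideal_cong_frev_feval:
  fixes p :: "'a::field mpoly"
  shows "ideal_cong n (frev (feval n p)) (feval n p)"
proof (rule poly_mapping_single_induct[of "\<lambda>p. ideal_cong n (frev (feval n p)) (feval n p)"])
  fix m and c :: 'a
  show "ideal_cong n (frev (feval n (Poly_Mapping.single m c))) (feval n (Poly_Mapping.single m c))"
    unfolding feval_single frev_mult frev_fconst fconst_central[symmetric]
    by (intro ideal_cong_mult_left ideal_cong_frev_fymon fcar_fconst)
qed (simp_all add: feval_add frev_add ideal_cong_add ideal_cong_refl)

definition fpsi_word :: "nat list \<Rightarrow> 'a::field nh_free"
  where "fpsi_word is = prod_list (map fpsi is)"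

lemma fcar_fpsi_word: "set is \<subseteq> {1..<n} \<Longrightarrow> fpsi_word is \<in> fcar n"
  unfolding fpsi_word_def by (intro fcar_prod_list) (auto simp del: One_nat_def intro!: fcar_fpsi)

lemma frev_fpsi_word: "frev (fpsi_word is) = fpsi_word (rev is)"
  by (simp add: fpsi_word_def frev_prod_list rev_map o_def)

lemma free_act_fpsi_word: "free_act (fpsi_word is) p = dd_word is p"
  unfolding fpsi_word_def by (induction "is") (simp_all add: free_act_mult)

lemma nh_psi_perm_eq:
  assumes "w permutes {1..n}"
  shows "\<exists>is. reduced_expr n w is \<and> nh_psi_perm n w = nh_class n (fpsi_word is)"
proof -
  define js where "js = (SOME is. reduced_expr n w is)"
  have red: "reduced_expr n w js"
    unfolding js_def by (rule someI_ex[OF exists_reduced_expr[OF assms]])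
  then have "set js \<subseteq> {1..<n}" by (simp add: reduced_expr_def)
  then have "nh_class n (fpsi_word js) = nh_prod_list n (map (nh_class n) (map fpsi js))"
    unfolding fpsi_word_def by (intro nh_class_prod_list) (auto simp del: One_nat_def intro!: fcar_fpsi)
  also have "\<dots> = nh_psi_perm n w"
    by (simp add: nh_psi_perm_def js_def nh_psi_def[abs_def] o_def)
  finally show ?thesis using red by blast
qed

lemma nh_class_sign: "nh_class n ((- 1) ^ (n * (n - 1) div 2)) = nh_sign n"
  by (simp add: nh_sign_def nh_class_power nh_class_uminus nh_class_1 fcar_uminus)

lemma free_act_minus_one_power: "free_act ((- 1) ^ k) p = (- 1) ^ k * p"
  unfolding minus_one_power_eq_fconst free_act_fconst minus_one_power_eq_PConst ..

theorem corollary2p10: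
  fixes n :: nat and l :: "nat \<Rightarrow> nat"
  assumes "n \<ge> 1" and "l \<in> partitions_le n"
  shows "nh_act (S_elt n l :: 'a::field nh_free set) 1 = schur n l
    \<and> (z_elt n l :: 'a nh_free set) = nh_eval n (schur n l)
    \<and> nh_cong n
        (nh_sign n \<otimes>\<^bsub>nilHecke n\<^esub> nh_psi_perm n (longest_perm n)
          \<otimes>\<^bsub>nilHecke n\<^esub> nh_ymonom n (\<lambda>k. l k + (n - k)))
        (nh_eval n (schur n l) :: 'a nh_free set) (J_left n)
    \<and> nh_cong n
        (nh_sign n \<otimes>\<^bsub>nilHecke n\<^esub> nh_ymonom n (\<lambda>k. l k + (n - k))
          \<otimes>\<^bsub>nilHecke n\<^esub> nh_psi_perm n (longest_perm n))
        (nh_eval n (schur n l) :: 'a nh_free set) (J_right n)"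
proof -
  let ?e = "\<lambda>k. l k + (n - k)" and ?s = "(- 1) ^ (n * (n - 1) div 2) :: 'a nh_free"
  let ?schur = "schur n l :: 'a mpoly"
  have "longest_perm n permutes {1..n}"
    unfolding longest_perm_eq_reversal by (rule reversal_permutes)
  then obtain "is" where red: "reduced_expr n (longest_perm n) is"
    and psi: "(nh_psi_perm n (longest_perm n) :: 'a nh_free set) = nh_class n (fpsi_word is)"
    using nh_psi_perm_eq by blast
  note red' = reduced_expr_longest_rev[OF red]
  have "set is \<subseteq> {1..<n}" using red by (simp add: reduced_expr_def)
  then have car: "?s \<in> fcar n" "(fpsi_word is :: 'a nh_free) \<in> fcar n"
      "(fpsi_word (rev is) :: 'a nh_free) \<in> fcar n" "(fymon n ?e :: 'a nh_free) \<in> fcar n"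
      "frev (fymon n ?e) \<in> fcar n"
    by (auto intro!: fcar_fpsi_word fcar_power fcar_uminus fcar_fymon fcar_frev simp del: One_nat_def)
  define a where "a = ?s * fpsi_word is * fymon n ?e"
  \<comment> \<open>The mirror image of the product in the second congruence: its word in the \<open>\<psi>\<^sub>r\<close> is again a reduced
    expression of the longest permutation, so it acts on \<open>1\<close> in the same way as \<open>a\<close>.\<close>
  define b where "b = ?s * fpsi_word (rev is) * frev (fymon n ?e)"
  have ab: "a \<in> fcar n" "b \<in> fcar n"
    unfolding a_def b_def by (intro fcar_mult car)+
  have act: "free_act a 1 = ?schur" "free_act b 1 = ?schur"
    unfolding a_def b_def schur_eq_dd_word[OF assms(1) red]
    by (simp_all add: dd_word_reduced_eq[OF red' red] free_act_mult free_act_minus_one_power free_act_fpsi_word free_act_fymon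
        free_act_frev_fymon)
  have schur: "?schur \<in> polys {1..n}"
    using free_act_polys[OF ab(1), of 1] by (simp add: act)
  have S: "S_elt n l = nh_class n a"
    unfolding S_elt_def psi a_def nh_class_mult[OF fcar_mult[OF car(1,2)] car(4)]
      nh_class_mult[OF car(1,2)] nh_class_sign nh_class_fymon ..
  have cong: "nh_cong n (nh_class n a) (nh_eval n ?schur) (J_left n)"
    unfolding nh_cong_def J_left_eq nh_class_feval[symmetric]
    using feval_free_act_1_cong[OF ab(1)] ab(1)
    by (simp add: act fcar_feval flip: nh_class_diff)
  have z: "z_elt n l = nh_eval n ?schur"
    unfolding z_elt_def S
  proof (rule the_equality)
    show "nh_eval n ?schur \<in> nh_ysubalg n \<and> nh_cong n (nh_class n a) (nh_eval n ?schur) (J_left n)"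
      using nh_class_feval_ysubalg[of n ?schur] cong by (simp add: nh_class_feval)
    fix z assume z: "z \<in> nh_ysubalg n \<and> nh_cong n (nh_class n a) z (J_left n)"
    then obtain p :: "'a mpoly" where p: "p \<in> polys {1..n}" "z = nh_class n (feval n p)"
      using nh_ysubalg_imp_eval by blast
    then have "free_act a 1 = p"
      using eval_cong_J_left_unique[OF ab(1) p(1)] z free_act_feval[OF p(1)] by simp
    then show "z = nh_eval n ?schur"
      using p(2) by (simp add: act nh_class_feval)
  qed
  have "frev b = fymon n ?e * fpsi_word is * ?s"
    by (simp add: b_def frev_mult frev_fpsi_word frev_power frev_uminus mult.assoc)
  also have "\<dots> = ?s * (fymon n ?e * fpsi_word is)"
    unfolding minus_one_power_eq_fconst by (rule fconst_central[symmetric])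
  finally have sym: "frev b = ?s * fymon n ?e * fpsi_word is"
    by (simp only: mult.assoc)
  have "frev b - feval n ?schur =
      frev (b - feval n ?schur) + (frev (feval n ?schur) - feval n ?schur)"
    by (simp add: frev_diff)
  also have "\<dots> \<in> psi_right n"
    using feval_free_act_1_cong[OF ab(2)] ideal_cong_frev_feval[of n ?schur]
    by (intro psi_right_add frev_psi_left nh_ideal_psi_right) (simp_all add: act ideal_cong_def)
  finally have "nh_cong n (nh_class n (frev b)) (nh_eval n ?schur) (J_right n)"
    unfolding nh_cong_def nh_class_feval[symmetric]
    using ab(2) psi_right_J_right by (simp add: fcar_feval fcar_frev flip: nh_class_diff)
  moreover have "nh_class n (frev b) = nh_sign n \<otimes>\<^bsub>nilHecke n\<^esub> nh_ymonom n ?e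
      \<otimes>\<^bsub>nilHecke n\<^esub> nh_psi_perm n (longest_perm n)"
    unfolding sym psi nh_class_mult[OF fcar_mult[OF car(1,4)] car(2)]
      nh_class_mult[OF car(1,4)] nh_class_sign nh_class_fymon ..
  ultimately show ?thesis
    using z cong S nh_act_nh_class[of n a 1] act(1) by (simp add: S_elt_def)
qed

end
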